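(* For every $X\in L^\infty(\mathcal F_T;\mathbb R^d)$ we have $$\rho(Y\cdot X)=\sup\{\mathbb E(Z_T\cdot X):\ Z\in\mathcal B^o,\ \mathbb E Z^1_T=1\}.$$ In particular, $$\mathcal B\cap L^\infty(\mathcal F_T;\mathbb R^d)=\{X\in L^\infty(\mathcal F_T;\mathbb R^d):\ \mathbb E_{\mathbb Q}(Y\cdot X)\le0\ \text{for all }\mathbb Q\in\mathcal Q\}=\{X\in L^\infty(\mathcal F_T;\mathbb R^d):\ \rho(Y\cdot X)\le0\}.$$
   Context: Let $(\Omega,\mathcal F,(\mathcal F_t)_{t=0,\dots,T},\mathbb P)$ be a filtered probability space and let $d$ assets be traded at times $0,\dots,T$ with an adapted bid-ask process $\pi=(\pi^{ij}_t)$, taking values in $\mathbb R^{d\times d}$ with positive entries: $\pi^{ij}_t$ is the number of units of asset $i$ which can be traded for one unit of asset $j$ at time $t$; $\pi^{ii}_t=1$ and $\pi^{i_0i_n}_t\le\pi^{i_0i_1}_t\cdots\pi^{i_{n-1}i_n}_t$ for all $t$ and all $i_0,\dots,i_n$. With $e_i$ the canonical basis of $\mathbb R^d$, $K_t\subset L^0(\mathcal F_t;\mathbb R^d)$ is the convex cone generated by positive $\mathcal F_t$-measurable multiples of the vectors $-e_i$ and $e_j-\pi^{ij}_te_i$, $1\le i,j\le d$. Let $\mathcal B=K_0+\dots+K_T$, assumed closed in $L^0(\mathcal F_T;\mathbb R^d)$ (convergence in probability) and arbitrage-free, i.e. $\mathcal B\cap L^0_+(\mathcal F_T;\mathbb R^d)=\{0\}$.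 Consistent price processes: $\mathcal B^o=\{Z\in L^1_+(\mathcal F_T;\mathbb R^d): Z>0\text{ a.s. (componentwise) and }Z_t\in K_t^{( * )}\text{ for all }t\}$, where $Z_t=\mathbb E(Z\mid\mathcal F_t)$ (so $Z_T=Z$), $Z^1_t$ is its first component, and $K_t^{( * )}=\{W\in L^1(\mathcal F_t;\mathbb R^d): W\cdot\xi\le0\text{ a.s. for all }\xi\in K_t\}$. Extra period: let $B^i=\pi^{1i}_T$, $S^i=1/\pi^{i1}_T$ and fix $\varepsilon>0$. Let $\tilde\Omega=\{0,1\}^{d-1}$ with its power set $\tilde{\mathcal F}$ and uniform measure $\tilde{\mathbb P}$, and $\hat\Omega=\Omega\times\tilde\Omega$, $\hat{\mathcal F}=\mathcal F\otimes\tilde{\mathcal F}$, $\hat{\mathbb P}=\mathbb P\otimes\tilde{\mathbb P}$. Define the $\mathbb R^d$-valued random vector $$Y(\omega,\tilde\omega)=e_1+\sum_{j=1}^{d-1}\{(1-\tilde\omega_j)(1-\varepsilon)S^{j+1}(\omega)+\tilde\omega_j(1+\varepsilon)B^{j+1}(\omega)\}e_{j+1}.$$ For $Z\in\mathcal B^o$ and $2\le i\le d$ put $\theta(\omega,i)=\dfrac{Z^i_T/Z^1_T-S^i(1-\varepsilon)}{B^i(1+\varepsilon)-S^i(1-\varepsilon)}$ and $$\lambda^{Z_T}(\omega,\tilde\omega)=\prod_{i=1}^{d-1}\theta(\omega,i+1)^{\tilde\omega_i}(1-\theta(\omega,i+1))^{1-\tilde\omega_i},$$ so that $\sum_{\tilde\omega}\lambda^{Z_T}(\cdot,\tilde\omega)=1$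 and $Z_T/Z^1_T=\sum_{\tilde\omega}\lambda^{Z_T}(\cdot,\tilde\omega)Y(\cdot,\tilde\omega)$. Set $$\mathcal Q=\Big\{\mathbb Q:\ \frac{d\mathbb Q}{d\hat{\mathbb P}}=2^{d-1}\frac{Z^1_T}{Z^1_0}\lambda^{Z_T},\ Z\in\mathcal B^o\Big\},$$ and let $\rho$ be the associated coherent risk measure, $\rho(W)=\sup_{\mathbb Q\in\mathcal Q}\mathbb E_{\mathbb Q}(W)$. Random variables on $\Omega$ are regarded as random variables on $\hat\Omega$ in the obvious way.
   Formalization: The initial sigma-algebra F_0 is assumed P-trivial (every event has probability 0 or 1); without this the claim fails, e.g. for d=1, T=0, π=1, where Q={P} and ρ(Y·X)=E X but the right-hand supremum is ess sup X. *)

theory Defs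
  imports "HOL-Probability.Probability"
begin

text \<open>
  Assets are indexed by a finite type \<open>'d\<close>, so \<open>d = CARD('d)\<close>. Asset 1, the one used as numeraire in
  \<open>B\<close>, \<open>S\<close>, \<open>Y\<close> and the extra period, is an arbitrary fixed element \<open>n\<close> of \<open>'d\<close>; the assets
  \<open>2, \<dots>, d\<close> are the elements of \<open>UNIV - {n}\<close>. Spaces \<open>L\<^sup>0\<close>, \<open>L\<^sup>1\<close> and \<open>L\<^sup>\<infinity>\<close> are represented by sets
  of functions, and sets of random variables by sets that are closed under a.s. equality.
\<close>

definition filtered_prob_space :: "'a measure \<Rightarrow> (nat \<Rightarrow> 'a measure) \<Rightarrow> nat \<Rightarrow> bool" where
  "filtered_prob_space M F T \<longleftrightarrow>
     prob_space M \<and>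
     (\<forall>t\<le>T. subalgebra M (F t)) \<and>
     (\<forall>s t. s \<le> t \<and> t \<le> T \<longrightarrow> subalgebra (F t) (F s))"

definition bid_ask_process ::
  "'a measure \<Rightarrow> (nat \<Rightarrow> 'a measure) \<Rightarrow> nat \<Rightarrow> (nat \<Rightarrow> 'a \<Rightarrow> real^'d^'d) \<Rightarrow> bool" where
  "bid_ask_process M F T \<pi> \<longleftrightarrow>
     (\<forall>t\<le>T. \<pi> t \<in> borel_measurable (F t) \<and>
       (\<forall>\<omega>\<in>space M.
         (\<forall>i j. 0 < \<pi> t \<omega> $ i $ j) \<and>
         (\<forall>i. \<pi> t \<omega> $ i $ i = 1) \<and>
         (\<forall>m (i :: nat \<Rightarrow> 'd). \<pi> t \<omega> $ i 0 $ i m \<le> (\<Prod>k<m. \<pi> t \<omega> $ i k $ i (Suc k)))))"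

text \<open>
  Sums of several multiples of the same generator and positive scalar factors are absorbed by the
  coefficients, so the convex cone generated by the multiples \<open>a v\<close>, \<open>a \<ge> 0\<close> measurable, of the
  finitely many generators \<open>v\<close> consists of the combinations with one coefficient for each \<open>v\<close>.
\<close>

definition trading_cone ::
  "'a measure \<Rightarrow> 'a measure \<Rightarrow> ('a \<Rightarrow> real^'d^'d) \<Rightarrow> ('a \<Rightarrow> real^'d) set" where
  "trading_cone M G p = {\<xi> \<in> borel_measurable G. \<exists>a b.
     (\<forall>i. a i \<in> borel_measurable G \<and> (\<forall>\<omega>\<in>space M. 0 \<le> a i \<omega>)) \<and>
     (\<forall>i j. b i j \<in> borel_measurable G \<and> (\<forall>\<omega>\<in>space M. 0 \<le> b i j \<omega>)) \<and>
     (AE \<omega> in M. \<xi> \<omega> = (\<Sum>i\<in>UNIV. a i \<omega> *\<^sub>R (- axis i 1))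
        + (\<Sum>i\<in>UNIV. \<Sum>j\<in>UNIV. b i j \<omega> *\<^sub>R (axis j 1 - p \<omega> $ i $ j *\<^sub>R axis i 1)))}"

definition attainable ::
  "'a measure \<Rightarrow> (nat \<Rightarrow> 'a measure) \<Rightarrow> nat \<Rightarrow> (nat \<Rightarrow> 'a \<Rightarrow> real^'d^'d) \<Rightarrow> ('a \<Rightarrow> real^'d) set" where
  "attainable M F T \<pi> = {X \<in> borel_measurable (F T). \<exists>\<xi>.
     (\<forall>t\<le>T. \<xi> t \<in> trading_cone M (F t) (\<pi> t)) \<and> (AE \<omega> in M. X \<omega> = (\<Sum>t\<le>T. \<xi> t \<omega>))}"

definition converges_in_prob ::
  "'a measure \<Rightarrow> (nat \<Rightarrow> 'a \<Rightarrow> 'b::real_normed_vector) \<Rightarrow> ('a \<Rightarrow> 'b) \<Rightarrow> bool" where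
  "converges_in_prob M X L \<longleftrightarrow>
     (\<forall>e>0. (\<lambda>k. measure M {\<omega> \<in> space M. e < norm (X k \<omega> - L \<omega>)}) \<longlonglongrightarrow> 0)"

text \<open>Convergence in probability is metrizable, so closed means sequentially closed.\<close>

definition closed_L0 ::
  "'a measure \<Rightarrow> 'a measure \<Rightarrow> ('a \<Rightarrow> 'b::real_normed_vector) set \<Rightarrow> bool" where
  "closed_L0 M G A \<longleftrightarrow>
     (\<forall>X L. (\<forall>k. X k \<in> A) \<and> L \<in> borel_measurable G \<and> converges_in_prob M X L \<longrightarrow> L \<in> A)"

definition arbitrage_free :: "'a measure \<Rightarrow> ('a \<Rightarrow> real^'d) set \<Rightarrow> bool" where
  "arbitrage_free M A \<longleftrightarrow>
     (\<forall>X\<in>A. (AE \<omega> in M. \<forall>i. 0 \<le> X \<omega> $ i) \<longrightarrow> (AE \<omega> in M. X \<omega> = 0))"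

definition L_infty :: "'a measure \<Rightarrow> 'a measure \<Rightarrow> ('a \<Rightarrow> 'b::real_normed_vector) set" where
  "L_infty M G = {X \<in> borel_measurable G. \<exists>C. AE \<omega> in M. norm (X \<omega>) \<le> C}"

definition vec_cond_exp :: "'a measure \<Rightarrow> 'a measure \<Rightarrow> ('a \<Rightarrow> real^'d) \<Rightarrow> 'a \<Rightarrow> real^'d" where
  "vec_cond_exp M G Z \<omega> = (\<chi> i. real_cond_exp M G (\<lambda>\<omega>'. Z \<omega>' $ i) \<omega>)"

definition polar_cone ::
  "'a measure \<Rightarrow> 'a measure \<Rightarrow> ('a \<Rightarrow> real^'d) set \<Rightarrow> ('a \<Rightarrow> real^'d) set" where
  "polar_cone M G K =
     {W \<in> borel_measurable G. integrable M W \<and> (\<forall>\<xi>\<in>K. AE \<omega> in M. W \<omega> \<bullet> \<xi> \<omega> \<le> 0)}"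

definition consistent_prices ::
  "'a measure \<Rightarrow> (nat \<Rightarrow> 'a measure) \<Rightarrow> nat \<Rightarrow> (nat \<Rightarrow> 'a \<Rightarrow> real^'d^'d) \<Rightarrow> ('a \<Rightarrow> real^'d) set" where
  "consistent_prices M F T \<pi> = {Z \<in> borel_measurable (F T). integrable M Z \<and>
     (AE \<omega> in M. \<forall>i. 0 < Z \<omega> $ i) \<and>
     (\<forall>t\<le>T. vec_cond_exp M (F t) Z \<in> polar_cone M (F t) (trading_cone M (F t) (\<pi> t)))}"

text \<open>
  In the extra period, coordinate \<open>j\<close> of \<open>{0,1}\<^sup>d\<^sup>-\<^sup>1\<close> is indexed by the asset \<open>j + 1\<close> it drives. The argument
  \<open>p\<close> below is the terminal matrix \<open>\<pi> T\<close>.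
\<close>

definition extra_space :: "'d::finite \<Rightarrow> ('d \<Rightarrow> nat) measure" where
  "extra_space n = uniform_count_measure (PiE (UNIV - {n}) (\<lambda>_. {0, 1}))"

definition ext_measure :: "'a measure \<Rightarrow> 'd::finite \<Rightarrow> ('a \<times> ('d \<Rightarrow> nat)) measure" where
  "ext_measure M n = M \<Otimes>\<^sub>M extra_space n"

definition buy :: "('a \<Rightarrow> real^'d^'d) \<Rightarrow> 'd \<Rightarrow> 'd \<Rightarrow> 'a \<Rightarrow> real" where
  "buy p n i \<omega> = p \<omega> $ n $ i"

definition sell :: "('a \<Rightarrow> real^'d^'d) \<Rightarrow> 'd \<Rightarrow> 'd \<Rightarrow> 'a \<Rightarrow> real" where
  "sell p n i \<omega> = 1 / p \<omega> $ i $ n"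

definition final_price ::
  "('a \<Rightarrow> real^'d^'d) \<Rightarrow> 'd \<Rightarrow> real \<Rightarrow> 'a \<times> ('d \<Rightarrow> nat) \<Rightarrow> real^'d" where
  "final_price p n \<epsilon> = (\<lambda>(\<omega>, w). axis n 1 + (\<Sum>j\<in>UNIV - {n}.
     ((1 - real (w j)) * (1 - \<epsilon>) * sell p n j \<omega> + real (w j) * (1 + \<epsilon>) * buy p n j \<omega>) *\<^sub>R axis j 1))"

definition theta ::
  "('a \<Rightarrow> real^'d^'d) \<Rightarrow> 'd \<Rightarrow> real \<Rightarrow> ('a \<Rightarrow> real^'d) \<Rightarrow> 'a \<Rightarrow> 'd \<Rightarrow> real" where
  "theta p n \<epsilon> Z \<omega> i =
     (Z \<omega> $ i / Z \<omega> $ n - sell p n i \<omega> * (1 - \<epsilon>)) /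
     (buy p n i \<omega> * (1 + \<epsilon>) - sell p n i \<omega> * (1 - \<epsilon>))"

definition lambda_weight ::
  "('a \<Rightarrow> real^'d^'d) \<Rightarrow> 'd \<Rightarrow> real \<Rightarrow> ('a \<Rightarrow> real^'d) \<Rightarrow> 'a \<Rightarrow> ('d \<Rightarrow> nat) \<Rightarrow> real" where
  "lambda_weight p n \<epsilon> Z \<omega> w =
     (\<Prod>i\<in>UNIV - {n}. theta p n \<epsilon> Z \<omega> i ^ w i * (1 - theta p n \<epsilon> Z \<omega> i) ^ (1 - w i))"

definition pricing_measures ::
  "'a measure \<Rightarrow> (nat \<Rightarrow> 'a measure) \<Rightarrow> nat \<Rightarrow> (nat \<Rightarrow> 'a \<Rightarrow> real^'d^'d) \<Rightarrow> 'd \<Rightarrow> real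
    \<Rightarrow> ('a \<times> ('d \<Rightarrow> nat)) measure set" where
  "pricing_measures M F T \<pi> n \<epsilon> =
     (\<lambda>Z. density (ext_measure M n) (\<lambda>(\<omega>, w). ennreal
        (2 ^ (CARD('d) - 1) * (Z \<omega> $ n / vec_cond_exp M (F 0) Z \<omega> $ n)
          * lambda_weight (\<pi> T) n \<epsilon> Z \<omega> w)))
     ` consistent_prices M F T \<pi>"

text \<open>
  The supremum is taken in the extended reals, so that no convention for unbounded or empty sets of
  reals intervenes. For bounded \<open>X\<close> and trivial \<open>\<F>\<^sub>0\<close> the variable \<open>Y \<bullet> X\<close> is integrable under each
  pricing measure, hence neither does the value 0 of the Bochner integral on non-integrable functions.
\<close>

definition coherent_risk :: "'b measure set \<Rightarrow> ('b \<Rightarrow> real) \<Rightarrow> ereal" where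
  "coherent_risk \<Q> W = (SUP Q\<in>\<Q>. ereal (\<integral>x. W x \<partial>Q))"

end

theory Submission
  imports Defs
begin

text \<open>
  By Hilbert space projection onto the \<open>L\<^sup>0\<close>-closed cone \<open>\<B>\<close>, every bounded \<open>X \<notin> \<B>\<close> is separated from \<open>\<B>\<close> by
  a square integrable \<open>Z\<close> with \<open>E(Z \<cdot> X) > 0 \<ge> E(Z \<cdot> c)\<close> for bounded \<open>c \<in> \<B>\<close>. Such a \<open>Z\<close> is nonnegative and
  its conditional expectations lie in the polars of the one-period cones. Applied to \<open>X = 1\<^sub>E e\<^sub>i\<close>, which is
  not attainable when there is no arbitrage, this gives an element of the polar that does not vanish on \<open>E\<close>;
  by exhaustion there is a strictly positive one, and adding a small multiple of it turns \<open>Z\<close> into a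
  consistent price process. Conversely \<open>E(Z \<cdot> X) \<le> 0\<close> for bounded attainable \<open>X\<close> and consistent \<open>Z\<close>.

  The extra period replaces the prices \<open>Z\<^sub>T / Z\<^sup>1\<^sub>T\<close> by independent two-point distributions with the same mean,
  so that \<open>E\<^sub>Q(Y \<cdot> X) = E(Z\<^sub>T \<cdot> X) / E(Z\<^sup>1\<^sub>T)\<close>, and normalizing \<open>Z\<close> makes the two suprema agree.
\<close>

section \<open>Separation in \<open>L\<^sup>2\<close>\<close>

text \<open>Three notions of size meet here: the cone is closed for convergence in probability,
  projection needs second moments, and consistent prices are merely integrable. Minimizing over the
  square integrable members of the cone is compatible with the first, since almost sure convergence
  of a minimizing sequence is all that closedness asks for; bounded claims are integrable against
  every price vector, so polars are compared on them only. In the other direction the obstacle is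
  that a bounded attainable claim may be a sum of trades that are unbounded and not integrable
  against prices, so its expected value cannot be split period by period. Triviality of
  \<open>F 0\<close> makes the initial price of the numeraire the constant \<open>E(Z $ n)\<close>:
  the density then normalizes \<open>Z\<close> by a number, and positive multiples of consistent
  prices are consistent. Positivity of \<open>\<epsilon>\<close> separates the two terminal prices
  of each asset even where bid and ask coincide, so the quotient defining \<open>theta\<close> has a
  positive denominator.\<close>

lemma AE_summable_norm:
  fixes f :: "nat \<Rightarrow> 'a \<Rightarrow> 'b::{banach, second_countable_topology}"
  assumes int: "\<And>k. integrable M (f k)" and sum: "summable (\<lambda>k. \<integral>\<omega>. norm (f k \<omega>) \<partial>M)"
  shows "AE \<omega> in M. summable (\<lambda>k. norm (f k \<omega>))"
proof -
  note [measurable] = borel_measurable_integrable[OF int]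
  have "(\<integral>\<^sup>+\<omega>. (\<Sum>k. ennreal (norm (f k \<omega>))) \<partial>M) = (\<Sum>k. \<integral>\<^sup>+\<omega>. norm (f k \<omega>) \<partial>M)"
    by (rule nn_integral_suminf) auto
  also have "\<dots> = (\<Sum>k. ennreal (\<integral>\<omega>. norm (f k \<omega>) \<partial>M))"
    by (intro arg_cong[where f=suminf] ext nn_integral_eq_integral integrable_norm int) auto
  also have "\<dots> = ennreal (\<Sum>k. \<integral>\<omega>. norm (f k \<omega>) \<partial>M)"
    by (intro suminf_ennreal2 sum) auto
  finally have "(\<integral>\<^sup>+\<omega>. (\<Sum>k. ennreal (norm (f k \<omega>))) \<partial>M) \<noteq> \<infinity>"
    by simp
  then have "AE \<omega> in M. (\<Sum>k. ennreal (norm (f k \<omega>))) \<noteq> \<infinity>"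
    by (intro nn_integral_PInf_AE) auto
  then show ?thesis
    by eventually_elim (intro summable_suminf_not_top, auto)
qed

text \<open>The indicators of the exceptional sets tend to 0 almost surely and are bounded by 1,
  which is integrable for a finite measure. This links the limits constructed below to the
  hypothesis \<open>closed_L0\<close>.\<close>

lemma (in finite_measure) AE_tendsto_imp_converges_in_prob:
  fixes X :: "nat \<Rightarrow> 'a \<Rightarrow> 'b::euclidean_space"
  assumes [measurable]: "\<And>k. X k \<in> borel_measurable M" "L \<in> borel_measurable M"
    and lim: "AE \<omega> in M. (\<lambda>k. X k \<omega>) \<longlonglongrightarrow> L \<omega>"
  shows "converges_in_prob M X L"
  unfolding converges_in_prob_def
proof (intro allI impI)
  fix e :: real assume e: "0 < e"
  let ?A = "\<lambda>k. {\<omega> \<in> space M. e < norm (X k \<omega> - L \<omega>)}"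
  have "AE \<omega> in M. (\<lambda>k. indicator (?A k) \<omega> :: real) \<longlonglongrightarrow> 0"
    using lim
  proof eventually_elim
    case (elim \<omega>)
    have "eventually (\<lambda>k. indicator (?A k) \<omega> = (0::real)) sequentially"
      using tendstoD[OF elim e] by eventually_elim (auto simp: dist_norm indicator_def)
    then show ?case by (rule tendsto_eventually)
  qed
  then have "(\<lambda>k. \<integral>\<omega>. indicator (?A k) \<omega> \<partial>M) \<longlonglongrightarrow> (\<integral>\<omega>. (0::real) \<partial>M)"
    by (intro integral_dominated_convergence[where w="\<lambda>_. 1"]) (auto simp: indicator_def)
  then show "(\<lambda>k. measure M (?A k)) \<longlonglongrightarrow> 0"
    by simp
qed

text \<open>The constant sequence \<open>X\<close> converges in probability to each of its
  versions.\<close>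

lemma closed_L0_AE_cong:
  fixes X :: "'a \<Rightarrow> 'b::euclidean_space"
  assumes "closed_L0 M G A" "X \<in> A" "Y \<in> borel_measurable G" "AE \<omega> in M. X \<omega> = Y \<omega>"
  shows "Y \<in> A"
proof -
  have "measure M {\<omega> \<in> space M. e < norm (X \<omega> - Y \<omega>)} = 0" if "e > 0" for e
  \<comment> \<open>\<open>X\<close> is not assumed measurable; if the set is not measurable either,
    \<open>measure\<close> has the default value 0.\<close>
  proof (cases "{\<omega> \<in> space M. e < norm (X \<omega> - Y \<omega>)} \<in> sets M")
    case True
    have "AE \<omega> in M. \<omega> \<notin> {\<omega> \<in> space M. e < norm (X \<omega> - Y \<omega>)}"
      using assms(4) that by (auto elim: eventually_mono)
    then show ?thesis
      using AE_iff_null_sets[OF True] measure_eq_0_null_sets by blast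
  qed (rule measure_notin_sets)
  then have "converges_in_prob M (\<lambda>_. X) Y"
    by (simp add: converges_in_prob_def)
  then show ?thesis
    using assms(1)[unfolded closed_L0_def, rule_format, of "\<lambda>_. X" Y] assms(2,3) by blast
qed

text \<open>Integrability of the squared norm does not give measurability of \<open>X\<close>
  itself, hence the separate measurability assumptions below.\<close>

abbreviation square_integrable :: "'a measure \<Rightarrow> ('a \<Rightarrow> 'b::euclidean_space) \<Rightarrow> bool" where
  "square_integrable M X \<equiv> integrable M (\<lambda>\<omega>. (norm (X \<omega>))\<^sup>2)"

lemma norm_add_sq_le:
  fixes x y :: "'b::real_inner"
  shows "(norm (x + y))\<^sup>2 \<le> 2 * (norm x)\<^sup>2 + 2 * (norm y)\<^sup>2"
proof -
  have "(norm (x + y))\<^sup>2 + (norm (x - y))\<^sup>2 = 2 * (norm x)\<^sup>2 + 2 * (norm y)\<^sup>2"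
    unfolding power2_norm_eq_inner by (simp add: algebra_simps)
  then show ?thesis
    using zero_le_power2[of "norm (x - y)"] by linarith
qed

lemma abs_inner_le_sq:
  fixes x y :: "'b::real_inner"
  shows "\<bar>x \<bullet> y\<bar> \<le> (norm x)\<^sup>2 + (norm y)\<^sup>2"
proof -
  have "0 \<le> norm x * norm y" by simp
  then show ?thesis
    using Cauchy_Schwarz_ineq2[of x y] sum_squares_bound[of "norm x" "norm y"]
    by (simp only: mult.assoc)
qed

lemma norm_le_sq_add_one:
  fixes x :: "'b::real_normed_vector"
  shows "norm x \<le> (norm x)\<^sup>2 + 1"
proof -
  have "0 \<le> (norm x - 1)\<^sup>2" by simp
  then have "2 * norm x \<le> (norm x)\<^sup>2 + 1"
    by (simp add: power2_eq_square algebra_simps)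
  then show ?thesis using norm_ge_zero[of x] by linarith
qed

lemma square_integrable_add:
  fixes X Y :: "'a \<Rightarrow> 'b::euclidean_space"
  assumes [measurable]: "X \<in> borel_measurable M" "Y \<in> borel_measurable M"
    and "square_integrable M X" "square_integrable M Y"
  shows "square_integrable M (\<lambda>\<omega>. X \<omega> + Y \<omega>)"
  by (rule Bochner_Integration.integrable_bound[where f="\<lambda>\<omega>. 2 * (norm (X \<omega>))\<^sup>2 + 2 * (norm (Y \<omega>))\<^sup>2"])
    (use assms in \<open>auto intro!: norm_add_sq_le\<close>)

lemma square_integrable_scaleR:
  fixes X :: "'a \<Rightarrow> 'b::euclidean_space"
  assumes "square_integrable M X"
  shows "square_integrable M (\<lambda>\<omega>. s *\<^sub>R X \<omega>)"
  using assms by (simp add: power_mult_distrib)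

lemma square_integrable_diff:
  fixes X Y :: "'a \<Rightarrow> 'b::euclidean_space"
  assumes [measurable]: "X \<in> borel_measurable M" "Y \<in> borel_measurable M"
    and "square_integrable M X" "square_integrable M Y"
  shows "square_integrable M (\<lambda>\<omega>. X \<omega> - Y \<omega>)"
  using square_integrable_add[of X M "\<lambda>\<omega>. - Y \<omega>"] assms by simp

lemma integrable_inner:
  fixes X Y :: "'a \<Rightarrow> 'b::euclidean_space"
  assumes [measurable]: "X \<in> borel_measurable M" "Y \<in> borel_measurable M"
    and "square_integrable M X" "square_integrable M Y"
  shows "integrable M (\<lambda>\<omega>. X \<omega> \<bullet> Y \<omega>)"
  by (rule Bochner_Integration.integrable_bound[where f="\<lambda>\<omega>. (norm (X \<omega>))\<^sup>2 + (norm (Y \<omega>))\<^sup>2"])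
    (use assms in \<open>auto intro!: abs_inner_le_sq\<close>)

lemma (in finite_measure) integrable_of_square_integrable:
  fixes Z :: "'a \<Rightarrow> 'b::euclidean_space"
  assumes [measurable]: "Z \<in> borel_measurable M" and "square_integrable M Z"
  shows "integrable M Z"
  by (rule Bochner_Integration.integrable_bound[where f="\<lambda>\<omega>. (norm (Z \<omega>))\<^sup>2 + 1"])
    (use assms in \<open>auto intro!: norm_le_sq_add_one\<close>)

text \<open>This is the squared distance along a line through the nearest point, from which
  first-order conditions are read off.\<close>

lemma integral_norm_add_scaled_sq:
  fixes X Y :: "'a \<Rightarrow> 'b::euclidean_space"
  assumes [measurable]: "X \<in> borel_measurable M" "Y \<in> borel_measurable M"
    and "square_integrable M X" "square_integrable M Y"
  shows "(\<integral>\<omega>. (norm (X \<omega> + s *\<^sub>R Y \<omega>))\<^sup>2 \<partial>M) =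
    (\<integral>\<omega>. (norm (X \<omega>))\<^sup>2 \<partial>M) + 2 * s * (\<integral>\<omega>. X \<omega> \<bullet> Y \<omega> \<partial>M) + s\<^sup>2 * (\<integral>\<omega>. (norm (Y \<omega>))\<^sup>2 \<partial>M)"
proof -
  have eq: "(norm (X \<omega> + s *\<^sub>R Y \<omega>))\<^sup>2 = (norm (X \<omega>))\<^sup>2 + (2 * s) * (X \<omega> \<bullet> Y \<omega>) + s\<^sup>2 * (norm (Y \<omega>))\<^sup>2" for \<omega>
    unfolding power2_norm_eq_inner by (simp add: algebra_simps inner_commute power2_eq_square)
  show ?thesis
    unfolding eq using assms integrable_inner[OF assms] by simp
qed

text \<open>Dividing by \<open>s\<close> and letting \<open>s\<close> tend to 0 leaves the linear
  term. Only \<open>s \<le> 1\<close> is tested, because the nearest point \<open>b\<close> is later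
  replaced by \<open>(1 - s) b\<close>, which has to stay in the cone.\<close>

lemma nonneg_of_quadratic_nonneg:
  fixes u v :: real
  assumes "\<And>s. 0 < s \<Longrightarrow> s \<le> 1 \<Longrightarrow> 0 \<le> 2 * s * u + s\<^sup>2 * v"
  shows "0 \<le> u"
proof (rule ccontr)
  assume "\<not> 0 \<le> u"
  \<comment> \<open>The second entry makes \<open>s * v\<close> at most \<open>- u\<close>, too
    little to compensate \<open>2 * u\<close>; adding 1 avoids division by zero.\<close>
  define s where "s = min 1 (- u / (\<bar>v\<bar> + 1))"
  have s: "0 < s" "s \<le> 1" using \<open>\<not> 0 \<le> u\<close> by (auto simp: s_def divide_neg_pos)
  have "s * (\<bar>v\<bar> + 1) \<le> - u / (\<bar>v\<bar> + 1) * (\<bar>v\<bar> + 1)"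
    by (intro mult_right_mono) (auto simp: s_def)
  then have "s * (\<bar>v\<bar> + 1) \<le> - u" by simp
  then have "s * v \<le> - u"
    using s mult_left_mono[of v "\<bar>v\<bar> + 1" s] by linarith
  then have "2 * u + s * v < 0" using \<open>\<not> 0 \<le> u\<close> by linarith
  then have "s * (2 * u + s * v) < 0" using s by (simp add: mult_pos_neg)
  with assms[OF s] show False by (simp add: algebra_simps power2_eq_square)
qed

lemma nonneg_of_affine_nonneg:
  fixes u v :: real
  assumes "\<And>s. 0 < s \<Longrightarrow> 0 \<le> u + s * v"
  shows "0 \<le> u"
proof (rule nonneg_of_quadratic_nonneg)
  fix s :: real assume "0 < s" "s \<le> 1"
  then have "0 \<le> (2 * s) * (u + s * v)"
    by (intro mult_nonneg_nonneg assms) auto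
  then show "0 \<le> 2 * s * u + s\<^sup>2 * (2 * v)"
    by (simp add: algebra_simps power2_eq_square)
qed

text \<open>A minimizing sequence with error \<open>4\<^sup>-\<^sup>k\<close> has increments of \<open>L\<^sup>1\<close> norm \<open>O(2\<^sup>-\<^sup>k)\<close> by the
  parallelogram law, so it converges almost surely; this replaces the completeness of \<open>L\<^sup>2\<close>.\<close>

lemma (in finite_measure) L2_nearest_point:
  fixes A :: "('a \<Rightarrow> 'b::euclidean_space) set"
  assumes G: "subalgebra M G" and A: "A \<subseteq> borel_measurable G" and closed: "closed_L0 M G A"
    and ne: "\<exists>c\<in>A. square_integrable M c"
    and mid: "\<And>c d. c \<in> A \<Longrightarrow> d \<in> A \<Longrightarrow> (\<lambda>\<omega>. (1/2) *\<^sub>R (c \<omega> + d \<omega>)) \<in> A"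
    and X[measurable]: "X \<in> borel_measurable M" and X2: "square_integrable M X"
  obtains b where "b \<in> A" "square_integrable M b"
    "\<And>c. c \<in> A \<Longrightarrow> square_integrable M c \<Longrightarrow>
       (\<integral>\<omega>. (norm (X \<omega> - b \<omega>))\<^sup>2 \<partial>M) \<le> (\<integral>\<omega>. (norm (X \<omega> - c \<omega>))\<^sup>2 \<partial>M)"
proof -
  define f where "f c = (\<integral>\<omega>. (norm (X \<omega> - c \<omega>))\<^sup>2 \<partial>M)" for c
  define D where "D = {c \<in> A. square_integrable M c}"
  define m where "m = (INF c\<in>D. f c)"
  have meas: "c \<in> borel_measurable M" if "c \<in> A" for c
    using A that measurable_from_subalg[OF G] by blast
  have f0: "0 \<le> f c" for c unfolding f_def by simp
  have bdd: "bdd_below (f ` D)" by (rule bdd_belowI[of _ 0]) (auto intro: f0)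
  have m_le: "m \<le> f c" if "c \<in> D" for c
    unfolding m_def by (rule cINF_lower[OF bdd that])
  have "\<exists>c\<in>D. f c < m + (1/4)^k" for k
    using cINF_less_iff[OF _ bdd, of "m + (1/4)^k"] ne unfolding m_def D_def by auto
  then obtain c where c: "\<And>k. c k \<in> D" "\<And>k. f (c k) < m + (1/4)^k" by metis
  have cA: "c k \<in> A" and [measurable]: "c k \<in> borel_measurable M" and c2: "square_integrable M (c k)" for k
    using c(1)[of k] meas by (auto simp: D_def)
  define dd where "dd k \<omega> = c (Suc k) \<omega> - c k \<omega>" for k \<omega>
  have dd[measurable]: "dd k \<in> borel_measurable M" for k unfolding dd_def by measurable
  have dd2: "square_integrable M (dd k)" for k
    unfolding dd_def by (intro square_integrable_diff) (auto intro: c2)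
  have D_mid: "(\<lambda>\<omega>. (1/2) *\<^sub>R (c (Suc k) \<omega> + c k \<omega>)) \<in> D" for k
    unfolding D_def mem_Collect_eq
    by (intro conjI mid cA square_integrable_scaleR square_integrable_add c2) auto
  have Ed: "(\<integral>\<omega>. (norm (dd k \<omega>))\<^sup>2 \<partial>M) \<le> 4 * (1/4)^k" for k
  proof -
    let ?e = "\<lambda>\<omega>. (1/2) *\<^sub>R (c (Suc k) \<omega> + c k \<omega>)"
    have i: "square_integrable M (\<lambda>\<omega>. X \<omega> - c j \<omega>)" for j
      by (intro square_integrable_diff X2 c2) auto
    have ie: "square_integrable M (\<lambda>\<omega>. X \<omega> - ?e \<omega>)"
      using D_mid[of k] by (intro square_integrable_diff X2) (auto simp: D_def)
    have pl: "(norm (dd k \<omega>))\<^sup>2 = 2 * (norm (X \<omega> - c (Suc k) \<omega>))\<^sup>2 + 2 * (norm (X \<omega> - c k \<omega>))\<^sup>2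
        - 4 * (norm (X \<omega> - ?e \<omega>))\<^sup>2" for \<omega>
      unfolding dd_def power2_norm_eq_inner
      by (simp add: inner_diff_left inner_diff_right inner_add_left inner_add_right inner_commute field_simps)
    have "(\<integral>\<omega>. (norm (dd k \<omega>))\<^sup>2 \<partial>M) = 2 * f (c (Suc k)) + 2 * f (c k) - 4 * f ?e"
      unfolding f_def pl using i i[of k] ie by (simp del: scaleR_add_right)
    also have "\<dots> \<le> 4 * (1/4)^k"
    proof -
      \<comment> \<open>The midpoint lies in \<open>D\<close>, so its distance is at least
        \<open>m\<close> and the terms in \<open>m\<close> cancel. What remains is at most
        \<open>5/2\<close> times \<open>(1/4)^k\<close>, rounded up to 4 times.\<close>
      have "f (c (Suc k)) < m + (1/4) * (1/4)^k" using c(2)[of "Suc k"] by (simp only: power_Suc)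
      moreover have "0 < (1/4::real)^k" by simp
      ultimately show ?thesis using c(2)[of k] m_le[OF D_mid[of k]] by argo
    qed
    finally show ?thesis .
  qed
  have dd_int: "integrable M (dd k)" for k
    by (rule integrable_of_square_integrable[OF dd dd2])
  have E_dd: "(\<integral>\<omega>. norm (dd k \<omega>) \<partial>M) \<le> (4 + measure M (space M)) * (1/2)^k" for k
  proof -
    \<comment> \<open>The weight \<open>2^k\<close> balances the two terms: as the second moment is
      of order \<open>(1/4)^k\<close>, both contribute order \<open>(1/2)^k\<close>.\<close>
    have le: "norm (dd k \<omega>) \<le> 2^k * (norm (dd k \<omega>))\<^sup>2 + (1/2)^k" for \<omega>
    proof -
      have "norm (2^k * norm (dd k \<omega>)) \<le> (norm (2^k * norm (dd k \<omega>)))\<^sup>2 + 1"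
        by (rule norm_le_sq_add_one)
      then show ?thesis
        by (simp add: field_simps power2_eq_square abs_mult)
    qed
    have "(\<integral>\<omega>. norm (dd k \<omega>) \<partial>M) \<le> (\<integral>\<omega>. 2^k * (norm (dd k \<omega>))\<^sup>2 + (1/2)^k \<partial>M)"
      using dd2 dd_int by (intro integral_mono le) auto
    also have "\<dots> = 2^k * (\<integral>\<omega>. (norm (dd k \<omega>))\<^sup>2 \<partial>M) + measure M (space M) * (1/2)^k"
      using dd2 by simp
    also have "\<dots> \<le> 2^k * (4 * (1/4)^k) + measure M (space M) * (1/2)^k"
      using Ed[of k] by (intro add_right_mono mult_left_mono) auto
    also have "2^k * (4 * (1/4::real)^k) = 4 * (1/2)^k"
      by (simp add: field_simps flip: power_mult_distrib)
    finally show ?thesis by (simp add: algebra_simps)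
  qed
  have "summable (\<lambda>k. \<integral>\<omega>. norm (dd k \<omega>) \<partial>M)"
    by (rule summable_comparison_test'[OF summable_mult[OF summable_geometric[of "1/2"]], where N=0])
      (use E_dd in auto)
  from AE_summable_norm[OF dd_int this]
  have conv: "AE \<omega> in M. convergent (\<lambda>k. c k \<omega>)"
  proof eventually_elim
    case (elim \<omega>)
    then have "summable (\<lambda>k. dd k \<omega>)" by (rule summable_norm_cancel)
    then have "convergent (\<lambda>n. \<Sum>k<n. dd k \<omega>)" by (simp add: summable_iff_convergent)
    then have "convergent (\<lambda>n. c n \<omega> - c 0 \<omega>)"
      unfolding dd_def using sum_lessThan_telescope[of "\<lambda>k. c k \<omega>"] by simp
    then show ?case
      using convergent_add[of "\<lambda>n. c n \<omega> - c 0 \<omega>" "\<lambda>_. c 0 \<omega>"] by (simp add: convergent_const)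
  qed
  \<comment> \<open>Where the sequence diverges, \<open>lim\<close> is some unspecified value, but
    the function is \<open>G\<close>-measurable all the same.\<close>
  define b where "b \<omega> = lim (\<lambda>k. c k \<omega>)" for \<omega>
  have lim: "AE \<omega> in M. (\<lambda>k. c k \<omega>) \<longlonglongrightarrow> b \<omega>"
    using conv by eventually_elim (simp add: b_def convergent_LIMSEQ_iff)
  have bG: "b \<in> borel_measurable G"
    unfolding b_def using cA A by (intro borel_measurable_lim_metric) auto
  then have b[measurable]: "b \<in> borel_measurable M" by (rule measurable_from_subalg[OF G])
  have bA: "b \<in> A"
    using closed bG cA AE_tendsto_imp_converges_in_prob[OF _ _ lim]
    unfolding closed_L0_def by (meson b \<open>\<And>k. c k \<in> borel_measurable M\<close>)
  have fn: "(\<integral>\<^sup>+\<omega>. ennreal ((norm (X \<omega> - d \<omega>))\<^sup>2) \<partial>M) = ennreal (f d)" if "d \<in> D" for d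
    unfolding f_def using that meas
    by (intro nn_integral_eq_integral square_integrable_diff X2) (auto simp: D_def)
  \<comment> \<open>Fatou's lemma, in nonnegative integrals because square integrability of
    \<open>X - b\<close> is itself one of its consequences.\<close>
  have "(\<integral>\<^sup>+\<omega>. ennreal ((norm (X \<omega> - b \<omega>))\<^sup>2) \<partial>M)
      = (\<integral>\<^sup>+\<omega>. liminf (\<lambda>k. ennreal ((norm (X \<omega> - c k \<omega>))\<^sup>2)) \<partial>M)"
  proof (rule nn_integral_cong_AE, use lim in eventually_elim)
    case (elim \<omega>)
    then have "(\<lambda>k. ennreal ((norm (X \<omega> - c k \<omega>))\<^sup>2)) \<longlonglongrightarrow> ennreal ((norm (X \<omega> - b \<omega>))\<^sup>2)"
      by (intro tendsto_ennrealI tendsto_intros)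
    then show ?case by (rule lim_imp_Liminf[OF trivial_limit_sequentially, symmetric])
  qed
  also have "\<dots> \<le> liminf (\<lambda>k. \<integral>\<^sup>+\<omega>. ennreal ((norm (X \<omega> - c k \<omega>))\<^sup>2) \<partial>M)"
    by (rule nn_integral_liminf) auto
  also have "\<dots> \<le> liminf (\<lambda>k. ennreal (m + (1/4)^k))"
    unfolding fn[OF c(1)]
    by (intro Liminf_mono always_eventually allI ennreal_leI less_imp_le c(2))
  also have "\<dots> = ennreal m"
  proof -
    have "(\<lambda>k. m + (1/4)^k) \<longlonglongrightarrow> m + 0"
      by (intro tendsto_intros LIMSEQ_power_zero) auto
    then show ?thesis by (intro lim_imp_Liminf tendsto_ennrealI) auto
  qed
  finally have fatou: "(\<integral>\<^sup>+\<omega>. ennreal ((norm (X \<omega> - b \<omega>))\<^sup>2) \<partial>M) \<le> ennreal m" .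
  then have Xb: "square_integrable M (\<lambda>\<omega>. X \<omega> - b \<omega>)"
    by (intro integrableI_bounded) (auto simp: less_top[symmetric] top_unique)
  have b2: "square_integrable M b"
    using square_integrable_diff[OF _ _ X2 Xb] by simp
  have "ennreal (f b) \<le> ennreal m"
    using fatou fn[of b] bA b2 by (simp add: D_def)
  moreover have "0 \<le> m"
    unfolding m_def using ne f0 by (intro cINF_greatest) (auto simp: D_def)
  ultimately have fb: "f b \<le> m" by simp
  show thesis
  proof (rule that[OF bA b2])
    fix c assume "c \<in> A" "square_integrable M c"
    then have "f b \<le> f c" using fb m_le[of c] by (auto simp: D_def)
    then show "(\<integral>\<omega>. (norm (X \<omega> - b \<omega>))\<^sup>2 \<partial>M) \<le> (\<integral>\<omega>. (norm (X \<omega> - c \<omega>))\<^sup>2 \<partial>M)"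
      by (simp add: f_def)
  qed
qed

text \<open>Let \<open>b\<close> be the nearest point and \<open>Z = X - b\<close>. Moving from
  \<open>b\<close> in a direction \<open>c\<close> of the cone gives
  \<open>E(Z \<bullet> c) \<le> 0\<close>, and shrinking \<open>b\<close> towards 0 gives
  \<open>E(Z \<bullet> b) \<ge> 0\<close>. Hence \<open>E(Z \<bullet> X)\<close> is at least the
  second moment of \<open>Z\<close>, which is positive as otherwise \<open>X\<close> would be a
  version of \<open>b\<close>.\<close>

lemma (in finite_measure) closed_cone_L2_separation:
  fixes A :: "('a \<Rightarrow> 'b::euclidean_space) set"
  assumes G: "subalgebra M G" and A: "A \<subseteq> borel_measurable G" and closed: "closed_L0 M G A"
    and zero: "(\<lambda>_. 0) \<in> A"
    and add: "\<And>c d. c \<in> A \<Longrightarrow> d \<in> A \<Longrightarrow> (\<lambda>\<omega>. c \<omega> + d \<omega>) \<in> A"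
    and scale: "\<And>c s. c \<in> A \<Longrightarrow> 0 \<le> s \<Longrightarrow> (\<lambda>\<omega>. s *\<^sub>R c \<omega>) \<in> A"
    and X: "X \<in> borel_measurable G" and X2: "square_integrable M X" and notin: "X \<notin> A"
  obtains Z where "Z \<in> borel_measurable G" "square_integrable M Z" "0 < (\<integral>\<omega>. Z \<omega> \<bullet> X \<omega> \<partial>M)"
    "\<And>c. c \<in> A \<Longrightarrow> square_integrable M c \<Longrightarrow> (\<integral>\<omega>. Z \<omega> \<bullet> c \<omega> \<partial>M) \<le> 0"
proof -
  note X_M[measurable] = measurable_from_subalg[OF G X]
  obtain b where b: "b \<in> A" and b2: "square_integrable M b"
    and min: "\<And>c. c \<in> A \<Longrightarrow> square_integrable M c \<Longrightarrow>
       (\<integral>\<omega>. (norm (X \<omega> - b \<omega>))\<^sup>2 \<partial>M) \<le> (\<integral>\<omega>. (norm (X \<omega> - c \<omega>))\<^sup>2 \<partial>M)"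
  proof (rule L2_nearest_point[OF G A closed _ _ X_M X2])
    show "\<exists>c\<in>A. square_integrable M c" using zero by (intro bexI[of _ "\<lambda>_. 0"]) auto
    show "(\<lambda>\<omega>. (1/2) *\<^sub>R (c \<omega> + d \<omega>)) \<in> A" if "c \<in> A" "d \<in> A" for c d
      using scale[OF add[OF that], of "1/2"] by simp
  qed blast
  have meas: "c \<in> borel_measurable M" if "c \<in> A" for c
    using A that measurable_from_subalg[OF G] by blast
  note b_M[measurable] = meas[OF b]
  define Z where "Z \<omega> = X \<omega> - b \<omega>" for \<omega>
  have ZG: "Z \<in> borel_measurable G" unfolding Z_def using X b A by (intro borel_measurable_diff) auto
  note Z_M[measurable] = measurable_from_subalg[OF G ZG]
  have Z2: "square_integrable M Z"
    unfolding Z_def by (intro square_integrable_diff X2 b2) auto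
  have neg: "(\<integral>\<omega>. Z \<omega> \<bullet> c \<omega> \<partial>M) \<le> 0" if c: "c \<in> A" and c2: "square_integrable M c" for c
  proof -
    note [measurable] = meas[OF c]
    have "0 \<le> - (\<integral>\<omega>. Z \<omega> \<bullet> c \<omega> \<partial>M)"
    proof (rule nonneg_of_quadratic_nonneg)
      fix s :: real assume s: "0 < s" "s \<le> 1"
      have "(\<integral>\<omega>. (norm (Z \<omega>))\<^sup>2 \<partial>M) \<le> (\<integral>\<omega>. (norm (X \<omega> - (b \<omega> + s *\<^sub>R c \<omega>)))\<^sup>2 \<partial>M)"
        unfolding Z_def using s
        by (intro min add b scale c square_integrable_add b2 square_integrable_scaleR c2) auto
      also have "\<dots> = (\<integral>\<omega>. (norm (Z \<omega> + (- s) *\<^sub>R c \<omega>))\<^sup>2 \<partial>M)"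
        by (simp add: Z_def algebra_simps)
      finally show "0 \<le> 2 * s * - (\<integral>\<omega>. Z \<omega> \<bullet> c \<omega> \<partial>M) + s\<^sup>2 * (\<integral>\<omega>. (norm (c \<omega>))\<^sup>2 \<partial>M)"
        using integral_norm_add_scaled_sq[OF _ _ Z2 c2, of "- s"] by simp
    qed
    then show ?thesis by simp
  qed
  have Zb: "0 \<le> (\<integral>\<omega>. Z \<omega> \<bullet> b \<omega> \<partial>M)"
  proof (rule nonneg_of_quadratic_nonneg)
    fix s :: real assume s: "0 < s" "s \<le> 1"
    have "(\<integral>\<omega>. (norm (Z \<omega>))\<^sup>2 \<partial>M) \<le> (\<integral>\<omega>. (norm (X \<omega> - (1 - s) *\<^sub>R b \<omega>))\<^sup>2 \<partial>M)"
      unfolding Z_def using s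
      by (intro min b scale b2 square_integrable_scaleR) auto
    also have "\<dots> = (\<integral>\<omega>. (norm (Z \<omega> + s *\<^sub>R b \<omega>))\<^sup>2 \<partial>M)"
      by (simp add: Z_def algebra_simps)
    finally show "0 \<le> 2 * s * (\<integral>\<omega>. Z \<omega> \<bullet> b \<omega> \<partial>M) + s\<^sup>2 * (\<integral>\<omega>. (norm (b \<omega>))\<^sup>2 \<partial>M)"
      using integral_norm_add_scaled_sq[OF _ _ Z2 b2, of s] by simp
  qed
  have "(\<integral>\<omega>. (norm (Z \<omega>))\<^sup>2 \<partial>M) \<noteq> 0"
  proof
    assume "(\<integral>\<omega>. (norm (Z \<omega>))\<^sup>2 \<partial>M) = 0"
    then have "AE \<omega> in M. b \<omega> = X \<omega>"
      using integral_nonneg_eq_0_iff_AE[OF Z2] by (auto simp: Z_def)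
    then show False using closed_L0_AE_cong[OF closed b X] notin by blast
  qed
  moreover have "0 \<le> (\<integral>\<omega>. (norm (Z \<omega>))\<^sup>2 \<partial>M)" by simp
  moreover have "(\<integral>\<omega>. Z \<omega> \<bullet> X \<omega> \<partial>M) = (\<integral>\<omega>. (norm (Z \<omega>))\<^sup>2 \<partial>M) + (\<integral>\<omega>. Z \<omega> \<bullet> b \<omega> \<partial>M)"
  proof -
    have "Z \<omega> \<bullet> X \<omega> = (norm (Z \<omega>))\<^sup>2 + Z \<omega> \<bullet> b \<omega>" for \<omega>
      by (simp add: Z_def power2_norm_eq_inner algebra_simps)
    then show ?thesis using Z2 integrable_inner[OF Z_M b_M Z2 b2] by simp
  qed
  ultimately show thesis
    using that[OF ZG Z2 _ neg] Zb by linarith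
qed

section \<open>Exhaustion and polars\<close>

text \<open>By \<open>Un\<close> the supremum of the measures over the family is attained. If a
  maximizer missed a set of positive measure, \<open>hit\<close> would supply a member meeting that
  set, and covering both would exceed the supremum. Inclusions hold only almost everywhere because
  the sets of positivity to which this is applied cover each other only up to null sets.\<close>

lemma (in finite_measure) exhaustion:
  assumes G: "subalgebra M G" and sets: "\<S> \<subseteq> sets G"
    and Un: "\<And>S :: nat \<Rightarrow> 'a set. (\<And>k. S k \<in> \<S>) \<Longrightarrow> \<exists>U\<in>\<S>. \<forall>k. AE \<omega> in M. \<omega> \<in> S k \<longrightarrow> \<omega> \<in> U"
    and hit: "\<And>E. E \<in> sets G \<Longrightarrow> 0 < measure M E \<Longrightarrow> \<exists>S\<in>\<S>. 0 < measure M (E \<inter> S)"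
    and ne: "\<S> \<noteq> {}"
  shows "\<exists>S\<in>\<S>. AE \<omega> in M. \<omega> \<in> S"
proof -
  define s where "s = (SUP S\<in>\<S>. measure M S)"
  have bdd: "bdd_above (measure M ` \<S>)"
    by (rule bdd_aboveI[of _ "measure M (space M)"]) (auto intro: bounded_measure)
  have le_s: "measure M S \<le> s" if "S \<in> \<S>" for S
    unfolding s_def by (rule cSUP_upper[OF that bdd])
  have "\<exists>S\<in>\<S>. s - 1 / Suc k < measure M S" for k
    using less_cSUP_iff[OF ne bdd, of "s - 1 / Suc k"] by (auto simp: s_def)
  then obtain S where S: "\<And>k. S k \<in> \<S>" "\<And>k. s - 1 / Suc k < measure M (S k)" by metis
  obtain U where U: "U \<in> \<S>" "\<And>k. AE \<omega> in M. \<omega> \<in> S k \<longrightarrow> \<omega> \<in> U"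
    using Un[of S] S(1) by blast
  have sets': "A \<in> sets M" if "A \<in> \<S>" for A
    using sets that G by (auto simp: subalgebra_def)
  have "s - 1 / Suc k \<le> measure M U" for k
    using S(2)[of k] finite_measure_mono_AE[OF U(2) sets'[OF U(1)], of k] by linarith
  moreover have "(\<lambda>k. s - 1 / Suc k) \<longlonglongrightarrow> s - 0"
    by (intro tendsto_intros LIMSEQ_Suc lim_1_over_n)
  ultimately have s_le: "s \<le> measure M U"
    by (intro LIMSEQ_le_const2[of "\<lambda>k. s - 1 / Suc k" s]) auto
  have "measure M (space M - U) = 0"
  proof (rule ccontr)
    assume "measure M (space M - U) \<noteq> 0"
    then have "0 < measure M (space M - U)" by (simp add: zero_less_measure_iff)
    moreover have "space M - U \<in> sets G"
      using sets U(1) G sets.compl_sets[of U G] by (auto simp: subalgebra_def)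
    ultimately obtain S' where S': "S' \<in> \<S>" "0 < measure M ((space M - U) \<inter> S')"
      using hit[of "space M - U"] by blast
    \<comment> \<open>A pair is covered by feeding the sequence \<open>U, S', S', ...\<close> to the
      countable hypothesis.\<close>
    have "\<exists>V\<in>\<S>. \<forall>k::nat. AE \<omega> in M. \<omega> \<in> (if k = 0 then U else S') \<longrightarrow> \<omega> \<in> V"
      by (rule Un[of "\<lambda>k. if k = 0 then U else S'"]) (use U(1) S'(1) in auto)
    then obtain V where V: "V \<in> \<S>" "\<And>k::nat. AE \<omega> in M. \<omega> \<in> (if k = 0 then U else S') \<longrightarrow> \<omega> \<in> V"
      by blast
    have "AE \<omega> in M. \<omega> \<in> U \<union> ((space M - U) \<inter> S') \<longrightarrow> \<omega> \<in> V"
      using V(2)[of 0] V(2)[of 1] by eventually_elim auto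
    then have "measure M (U \<union> ((space M - U) \<inter> S')) \<le> measure M V"
      by (rule finite_measure_mono_AE) (rule sets'[OF V(1)])
    moreover have "measure M (U \<union> ((space M - U) \<inter> S')) = measure M U + measure M ((space M - U) \<inter> S')"
      using sets'[OF U(1)] sets'[OF S'(1)] by (intro finite_measure_Union) auto
    ultimately show False using S'(2) s_le le_s[OF V(1)] by linarith
  qed
  then have "AE \<omega> in M. \<omega> \<notin> space M - U"
    using sets'[OF U(1)] by (subst AE_iff_measurable[OF _ refl]) (auto simp: emeasure_eq_measure Int_def set_diff_eq)
  then show ?thesis using U(1) by (auto elim!: eventually_mono AE_mp intro!: AE_I2)
qed

text \<open>Unlike the polar in \<open>L\<^sup>2\<close> that the projection produces, this larger one, tested on bounded elements
  only, is closed under \<open>L\<^sup>1\<close>-convergent series, which the exhaustion needs.\<close>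

definition bounded_polar ::
  "'a measure \<Rightarrow> 'a measure \<Rightarrow> ('a \<Rightarrow> real^'d) set \<Rightarrow> ('a \<Rightarrow> real^'d) set" where
  "bounded_polar M G A = {Z \<in> borel_measurable G. integrable M Z \<and>
     (\<forall>c\<in>A \<inter> L_infty M G. (\<integral>\<omega>. Z \<omega> \<bullet> c \<omega> \<partial>M) \<le> 0)}"

lemma bounded_polarD:
  assumes "Z \<in> bounded_polar M G A" "c \<in> A \<inter> L_infty M G"
  shows "(\<integral>\<omega>. Z \<omega> \<bullet> c \<omega> \<partial>M) \<le> 0"
  using assms by (simp add: bounded_polar_def)

lemma integrable_inner_bounded:
  fixes Z c :: "'a \<Rightarrow> 'b::euclidean_space"
  assumes "integrable M Z" and [measurable]: "c \<in> borel_measurable M"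
    and "AE \<omega> in M. norm (c \<omega>) \<le> C"
  shows "integrable M (\<lambda>\<omega>. Z \<omega> \<bullet> c \<omega>)"
proof -
  note [measurable] = borel_measurable_integrable[OF assms(1)]
  show ?thesis
  proof (rule Bochner_Integration.integrable_bound[where f="\<lambda>\<omega>. C * norm (Z \<omega>)"])
    show "AE \<omega> in M. norm (Z \<omega> \<bullet> c \<omega>) \<le> norm (C * norm (Z \<omega>))"
      using assms(3)
    proof eventually_elim
      case (elim \<omega>)
      have "\<bar>Z \<omega> \<bullet> c \<omega>\<bar> \<le> norm (Z \<omega>) * norm (c \<omega>)" by (rule Cauchy_Schwarz_ineq2)
      also have "\<dots> \<le> norm (Z \<omega>) * \<bar>C\<bar>" using elim by (intro mult_left_mono) auto
      finally show ?case by (simp add: abs_mult mult.commute)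
    qed
  qed (use assms(1) in auto)
qed

lemma integrable_inner_L_infty:
  assumes "subalgebra M G" "integrable M Z" "c \<in> L_infty M G"
  shows "integrable M (\<lambda>\<omega>. Z \<omega> \<bullet> (c \<omega> :: real^'d))"
  using assms integrable_inner_bounded measurable_from_subalg unfolding L_infty_def by blast

lemma bounded_polar_add:
  assumes "subalgebra M G" "Z \<in> bounded_polar M G A" "W \<in> bounded_polar M G A"
  shows "(\<lambda>\<omega>. Z \<omega> + W \<omega>) \<in> bounded_polar M G A"
  using assms unfolding bounded_polar_def
  by (auto simp: inner_add_left integrable_inner_L_infty intro!: add_nonpos_nonpos)

lemma bounded_polar_scaleR:
  assumes "Z \<in> bounded_polar M G A" "0 \<le> s"
  shows "(\<lambda>\<omega>. s *\<^sub>R Z \<omega>) \<in> bounded_polar M G A"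
  using assms unfolding bounded_polar_def by (auto simp: mult_nonneg_nonpos)

text \<open>Against a claim bounded by \<open>C\<close>, the expected absolute values of the terms
  are dominated by \<open>\<bar>C\<bar>\<close> times the given summable series, so the inequality
  can be integrated term by term.\<close>

lemma bounded_polar_suminf:
  fixes Z :: "nat \<Rightarrow> 'a \<Rightarrow> real^'d"
  assumes G: "subalgebra M G" and Z: "\<And>k. Z k \<in> bounded_polar M G A"
    and sum: "summable (\<lambda>k. \<integral>\<omega>. norm (Z k \<omega>) \<partial>M)"
  shows "(\<lambda>\<omega>. \<Sum>k. Z k \<omega>) \<in> bounded_polar M G A"
proof -
  have int: "integrable M (Z k)" and ZG: "Z k \<in> borel_measurable G" for k
    using Z[of k] by (auto simp: bounded_polar_def)
  note ae = AE_summable_norm[OF int sum]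
  have "(\<integral>\<omega>. (\<Sum>k. Z k \<omega>) \<bullet> c \<omega> \<partial>M) \<le> 0" if c: "c \<in> A" "c \<in> L_infty M G" for c
  proof -
    obtain C where C: "AE \<omega> in M. norm (c \<omega>) \<le> C" using c(2) by (auto simp: L_infty_def)
    note [measurable] = borel_measurable_integrable[OF int]
    have [measurable]: "c \<in> borel_measurable M"
      using c(2) measurable_from_subalg[OF G] by (auto simp: L_infty_def)
    note ci = integrable_inner_L_infty[OF G int c(2)]
    have bnd: "AE \<omega> in M. norm (Z k \<omega> \<bullet> c \<omega>) \<le> \<bar>C\<bar> * norm (Z k \<omega>)" for k
      using C
    proof eventually_elim
      case (elim \<omega>)
      have "\<bar>Z k \<omega> \<bullet> c \<omega>\<bar> \<le> norm (Z k \<omega>) * norm (c \<omega>)" by (rule Cauchy_Schwarz_ineq2)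
      also have "\<dots> \<le> norm (Z k \<omega>) * \<bar>C\<bar>" using elim by (intro mult_left_mono) auto
      finally show ?case by (simp add: mult.commute)
    qed
    have sc: "summable (\<lambda>k. \<integral>\<omega>. norm (Z k \<omega> \<bullet> c \<omega>) \<partial>M)"
    proof (rule summable_comparison_test'[OF summable_mult[OF sum, of "\<bar>C\<bar>"], where N=0])
      fix k
      have "(\<integral>\<omega>. norm (Z k \<omega> \<bullet> c \<omega>) \<partial>M) \<le> (\<integral>\<omega>. \<bar>C\<bar> * norm (Z k \<omega>) \<partial>M)"
        by (intro integral_mono_AE integrable_norm ci integrable_mult_right int bnd)
      then show "norm (\<integral>\<omega>. norm (Z k \<omega> \<bullet> c \<omega>) \<partial>M) \<le> \<bar>C\<bar> * (\<integral>\<omega>. norm (Z k \<omega>) \<partial>M)"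
        by simp
    qed
    have "AE \<omega> in M. (\<Sum>k. Z k \<omega>) \<bullet> c \<omega> = (\<Sum>k. Z k \<omega> \<bullet> c \<omega>)"
      using ae by eventually_elim
        (rule bounded_linear.suminf[OF bounded_linear_inner_left summable_norm_cancel])
    then have "(\<integral>\<omega>. (\<Sum>k. Z k \<omega>) \<bullet> c \<omega> \<partial>M) = (\<integral>\<omega>. (\<Sum>k. Z k \<omega> \<bullet> c \<omega>) \<partial>M)"
      by (intro integral_cong_AE) measurable
    also have "\<dots> = (\<Sum>k. \<integral>\<omega>. Z k \<omega> \<bullet> c \<omega> \<partial>M)"
      by (rule integral_suminf[OF ci AE_summable_norm[OF ci sc] sc])
    also have "\<dots> \<le> (\<Sum>k. 0)"
      by (rule suminf_le) (use Z c in \<open>auto simp: bounded_polar_def summable_integral[OF ci AE_summable_norm[OF ci sc] sc]\<close>)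
    finally show ?thesis by simp
  qed
  then show ?thesis
    unfolding bounded_polar_def using integrable_suminf[OF int ae sum] ZG by auto
qed

section \<open>Trading cones and conditional expectations\<close>

lemma borel_measurable_vec_nth [measurable (raw)]:
  fixes f :: "'a \<Rightarrow> 'b::euclidean_space ^ 'd"
  assumes "f \<in> borel_measurable M"
  shows "(\<lambda>\<omega>. f \<omega> $ i) \<in> borel_measurable M"
  by (rule borel_measurable_continuous_on[OF _ assms]) (intro continuous_intros)

lemma borel_measurable_vec_lambda [measurable (raw)]:
  fixes f :: "'d::finite \<Rightarrow> 'a \<Rightarrow> real"
  assumes "\<And>i. f i \<in> borel_measurable M"
  shows "(\<lambda>\<omega>. \<chi> i. f i \<omega>) \<in> borel_measurable M"
proof (rule borel_measurable_euclidean_space[THEN iffD2], intro ballI)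
  fix b :: "real^'d" assume "b \<in> Basis"
  then obtain i where "b = axis i 1" by (auto simp: Basis_vec_def)
  then show "(\<lambda>\<omega>. (\<chi> i. f i \<omega>) \<bullet> b) \<in> borel_measurable M"
    using assms by (simp add: inner_axis)
qed

lemma integrable_vec_nth:
  fixes f :: "'a \<Rightarrow> real^'d"
  assumes "integrable M f"
  shows "integrable M (\<lambda>\<omega>. f \<omega> $ i)"
  using integrable_inner_left[of "axis i 1" M f] assms by (simp add: inner_axis)

lemma integrable_vecI:
  fixes f :: "'a \<Rightarrow> real^'d"
  assumes "\<And>i. integrable M (\<lambda>\<omega>. f \<omega> $ i)"
  shows "integrable M f"
proof -
  have "integrable M (\<lambda>\<omega>. \<Sum>i\<in>UNIV. (f \<omega> $ i) *\<^sub>R axis i (1::real))"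
    using assms by auto
  moreover have "(\<Sum>i\<in>UNIV. (f \<omega> $ i) *\<^sub>R axis i (1::real)) = f \<omega>" for \<omega>
    by (simp add: vec_eq_iff axis_def if_distrib cong: if_cong)
  ultimately show ?thesis by simp
qed

lemma polar_coneD:
  assumes "W \<in> polar_cone M G K" "\<xi> \<in> K"
  shows "AE \<omega> in M. W \<omega> \<bullet> \<xi> \<omega> \<le> 0"
  using assms by (simp add: polar_cone_def)

section \<open>Algebra of the one-period cones\<close>

lemma trading_cone_measurable: "\<xi> \<in> trading_cone M G p \<Longrightarrow> \<xi> \<in> borel_measurable G"
  by (simp add: trading_cone_def)

lemma trading_cone_zero: "(\<lambda>_. 0) \<in> trading_cone M G p"
  unfolding trading_cone_def
  by (intro CollectI conjI exI[of _ "\<lambda>_ _. 0"] exI[of _ "\<lambda>_ _ _. 0"]) auto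

lemma trading_cone_add:
  assumes "\<xi> \<in> trading_cone M G p" "\<eta> \<in> trading_cone M G p"
  shows "(\<lambda>\<omega>. \<xi> \<omega> + \<eta> \<omega>) \<in> trading_cone M G p"
proof -
  obtain a b where ab: "\<xi> \<in> borel_measurable G"
    "\<And>i. a i \<in> borel_measurable G" "\<And>i \<omega>. \<omega> \<in> space M \<Longrightarrow> 0 \<le> a i \<omega>"
    "\<And>i j. b i j \<in> borel_measurable G" "\<And>i j \<omega>. \<omega> \<in> space M \<Longrightarrow> 0 \<le> b i j \<omega>"
    "AE \<omega> in M. \<xi> \<omega> = (\<Sum>i\<in>UNIV. a i \<omega> *\<^sub>R (- axis i 1))
        + (\<Sum>i\<in>UNIV. \<Sum>j\<in>UNIV. b i j \<omega> *\<^sub>R (axis j 1 - p \<omega> $ i $ j *\<^sub>R axis i 1))"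
    using assms(1) unfolding trading_cone_def by blast
  obtain a' b' where ab': "\<eta> \<in> borel_measurable G"
    "\<And>i. a' i \<in> borel_measurable G" "\<And>i \<omega>. \<omega> \<in> space M \<Longrightarrow> 0 \<le> a' i \<omega>"
    "\<And>i j. b' i j \<in> borel_measurable G" "\<And>i j \<omega>. \<omega> \<in> space M \<Longrightarrow> 0 \<le> b' i j \<omega>"
    "AE \<omega> in M. \<eta> \<omega> = (\<Sum>i\<in>UNIV. a' i \<omega> *\<^sub>R (- axis i 1))
        + (\<Sum>i\<in>UNIV. \<Sum>j\<in>UNIV. b' i j \<omega> *\<^sub>R (axis j 1 - p \<omega> $ i $ j *\<^sub>R axis i 1))"
    using assms(2) unfolding trading_cone_def by blast
  show ?thesis
    unfolding trading_cone_def
  proof (intro CollectI conjI exI[of _ "\<lambda>i \<omega>. a i \<omega> + a' i \<omega>"] exI[of _ "\<lambda>i j \<omega>. b i j \<omega> + b' i j \<omega>"] allI ballI)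
    show "AE \<omega> in M. \<xi> \<omega> + \<eta> \<omega> = (\<Sum>i\<in>UNIV. (a i \<omega> + a' i \<omega>) *\<^sub>R (- axis i 1))
        + (\<Sum>i\<in>UNIV. \<Sum>j\<in>UNIV. (b i j \<omega> + b' i j \<omega>) *\<^sub>R (axis j 1 - p \<omega> $ i $ j *\<^sub>R axis i 1))"
      using ab(6) ab'(6) by eventually_elim (simp only: scaleR_left_distrib sum.distrib, simp)
  qed (use ab(1-5) ab'(1-5) in \<open>auto intro!: add_nonneg_nonneg\<close>)
qed

text \<open>A random factor is allowed because the coefficients of the generators are arbitrary
  nonnegative measurable functions. With an indicator as factor, a trade is restricted to an event
  known at the time of trading.\<close>

lemma trading_cone_scaleR:
  assumes "\<xi> \<in> trading_cone M G p" and "\<phi> \<in> borel_measurable G" and "\<And>\<omega>. 0 \<le> \<phi> \<omega>"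
  shows "(\<lambda>\<omega>. \<phi> \<omega> *\<^sub>R \<xi> \<omega>) \<in> trading_cone M G p"
proof -
  obtain a b where ab: "\<xi> \<in> borel_measurable G"
    "\<And>i. a i \<in> borel_measurable G" "\<And>i \<omega>. \<omega> \<in> space M \<Longrightarrow> 0 \<le> a i \<omega>"
    "\<And>i j. b i j \<in> borel_measurable G" "\<And>i j \<omega>. \<omega> \<in> space M \<Longrightarrow> 0 \<le> b i j \<omega>"
    "AE \<omega> in M. \<xi> \<omega> = (\<Sum>i\<in>UNIV. a i \<omega> *\<^sub>R (- axis i 1))
        + (\<Sum>i\<in>UNIV. \<Sum>j\<in>UNIV. b i j \<omega> *\<^sub>R (axis j 1 - p \<omega> $ i $ j *\<^sub>R axis i 1))"
    using assms(1) unfolding trading_cone_def by blast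
  show ?thesis
    unfolding trading_cone_def
  proof (intro CollectI conjI exI[of _ "\<lambda>i \<omega>. \<phi> \<omega> * a i \<omega>"] exI[of _ "\<lambda>i j \<omega>. \<phi> \<omega> * b i j \<omega>"] allI ballI)
    show "AE \<omega> in M. \<phi> \<omega> *\<^sub>R \<xi> \<omega> = (\<Sum>i\<in>UNIV. (\<phi> \<omega> * a i \<omega>) *\<^sub>R (- axis i 1))
        + (\<Sum>i\<in>UNIV. \<Sum>j\<in>UNIV. (\<phi> \<omega> * b i j \<omega>) *\<^sub>R (axis j 1 - p \<omega> $ i $ j *\<^sub>R axis i 1))"
      using ab(6) by eventually_elim (simp only: scaleR_right_distrib scaleR_sum_right scaleR_scaleR)
  qed (use ab(1-5) assms(2,3) in auto)
qed

lemma trading_cone_neg_axis: "(\<lambda>_. - axis i 1) \<in> trading_cone M G p"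
  unfolding trading_cone_def
  by (intro CollectI conjI exI[of _ "\<lambda>k _. if k = i then 1 else 0"] exI[of _ "\<lambda>_ _ _. 0"])
    (auto simp: if_distrib[of "\<lambda>x. x *\<^sub>R _"] sum_negf cong: if_cong)

lemma trading_cone_exchange:
  assumes "p \<in> borel_measurable G"
  shows "(\<lambda>\<omega>. axis j 1 - p \<omega> $ i $ j *\<^sub>R axis i 1) \<in> trading_cone M G p"
proof -
  have "(\<Sum>k\<in>UNIV. \<Sum>l\<in>UNIV. (if k = i \<and> l = j then 1 else 0) *\<^sub>R (axis l 1 - p \<omega> $ k $ l *\<^sub>R axis k 1))
      = axis j 1 - p \<omega> $ i $ j *\<^sub>R axis i (1::real)" for \<omega>
  proof -
    have "(\<Sum>l\<in>UNIV. (if k = i \<and> l = j then 1 else 0) *\<^sub>R (axis l 1 - p \<omega> $ k $ l *\<^sub>R axis k 1))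
      = (if k = i then axis j 1 - p \<omega> $ i $ j *\<^sub>R axis i (1::real) else 0)" for k
      by (auto simp: if_distrib[of "\<lambda>x. x *\<^sub>R _"] cong: if_cong)
    then show ?thesis by simp
  qed
  then show ?thesis
    unfolding trading_cone_def using assms
    by (intro CollectI conjI exI[of _ "\<lambda>_ _. 0"] exI[of _ "\<lambda>k l _. if k = i \<and> l = j then 1 else 0"]) auto
qed

section \<open>The cone of attainable claims\<close>

locale bid_ask_market = prob_space M for M :: "'a measure" +
  fixes F :: "nat \<Rightarrow> 'a measure" and T :: nat and \<pi> :: "nat \<Rightarrow> 'a \<Rightarrow> real^'d^'d"
  assumes sub: "\<And>t. t \<le> T \<Longrightarrow> subalgebra M (F t)"
    and filt: "\<And>s t. s \<le> t \<Longrightarrow> t \<le> T \<Longrightarrow> subalgebra (F t) (F s)"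
    and bid_ask: "bid_ask_process M F T \<pi>"
begin

lemma \<pi>_measurable: "t \<le> T \<Longrightarrow> \<pi> t \<in> borel_measurable (F t)"
  using bid_ask by (simp add: bid_ask_process_def)

lemma \<pi>_pos: "t \<le> T \<Longrightarrow> \<omega> \<in> space M \<Longrightarrow> 0 < \<pi> t \<omega> $ i $ j"
  using bid_ask by (simp add: bid_ask_process_def)

abbreviation "\<B> \<equiv> attainable M F T \<pi>"

lemma attainable_measurable: "X \<in> \<B> \<Longrightarrow> X \<in> borel_measurable (F T)"
  by (simp add: attainable_def)

lemma trading_cone_subset_attainable:
  assumes "t \<le> T" "\<xi> \<in> trading_cone M (F t) (\<pi> t)"
  shows "\<xi> \<in> \<B>"
proof -
  have "\<xi> \<in> borel_measurable (F T)"
    using measurable_from_subalg[OF filt] trading_cone_measurable assms by blast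
  moreover have "(\<lambda>\<omega>. if s = t then \<xi> \<omega> else 0) \<in> trading_cone M (F s) (\<pi> s)" for s
    using assms(2) trading_cone_zero by (cases "s = t") auto
  moreover have "(\<Sum>s\<le>T. (if s = t then \<xi> \<omega> else 0)) = \<xi> \<omega>" for \<omega>
    using assms(1) by simp
  ultimately show ?thesis
    unfolding attainable_def
    by (intro CollectI conjI exI[of _ "\<lambda>s \<omega>. if s = t then \<xi> \<omega> else 0"]) auto
qed

lemma attainable_zero: "(\<lambda>_. 0) \<in> \<B>"
  using trading_cone_subset_attainable[OF le_refl trading_cone_zero] .

lemma attainable_add:
  assumes "X \<in> \<B>" "Y \<in> \<B>"
  shows "(\<lambda>\<omega>. X \<omega> + Y \<omega>) \<in> \<B>"
proof -
  obtain \<xi> where \<xi>: "\<And>t. t \<le> T \<Longrightarrow> \<xi> t \<in> trading_cone M (F t) (\<pi> t)" "AE \<omega> in M. X \<omega> = (\<Sum>t\<le>T. \<xi> t \<omega>)"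
    using assms(1) unfolding attainable_def by blast
  obtain \<eta> where \<eta>: "\<And>t. t \<le> T \<Longrightarrow> \<eta> t \<in> trading_cone M (F t) (\<pi> t)" "AE \<omega> in M. Y \<omega> = (\<Sum>t\<le>T. \<eta> t \<omega>)"
    using assms(2) unfolding attainable_def by blast
  have "AE \<omega> in M. X \<omega> + Y \<omega> = (\<Sum>t\<le>T. \<xi> t \<omega> + \<eta> t \<omega>)"
    using \<xi>(2) \<eta>(2) by eventually_elim (simp add: sum.distrib)
  then show ?thesis
    unfolding attainable_def using assms[THEN attainable_measurable] trading_cone_add[OF \<xi>(1) \<eta>(1)]
    by (intro CollectI conjI exI[of _ "\<lambda>t \<omega>. \<xi> t \<omega> + \<eta> t \<omega>"]) auto
qed

lemma attainable_scaleR: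
  assumes "X \<in> \<B>" "0 \<le> s"
  shows "(\<lambda>\<omega>. s *\<^sub>R X \<omega>) \<in> \<B>"
proof -
  obtain \<xi> where \<xi>: "\<And>t. t \<le> T \<Longrightarrow> \<xi> t \<in> trading_cone M (F t) (\<pi> t)" "AE \<omega> in M. X \<omega> = (\<Sum>t\<le>T. \<xi> t \<omega>)"
    using assms(1) unfolding attainable_def by blast
  have "AE \<omega> in M. s *\<^sub>R X \<omega> = (\<Sum>t\<le>T. s *\<^sub>R \<xi> t \<omega>)"
    using \<xi>(2) by eventually_elim (simp add: scaleR_sum_right)
  then show ?thesis
    unfolding attainable_def
    using assms(1)[THEN attainable_measurable] trading_cone_scaleR[OF \<xi>(1), of _ "\<lambda>_. s"] assms(2)
    by (intro CollectI conjI exI[of _ "\<lambda>t \<omega>. s *\<^sub>R \<xi> t \<omega>"]) auto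
qed

end

section \<open>Conditional expectations of vectors and tests on events\<close>

lemma (in finite_measure_subalgebra) vec_cond_exp_measurable:
  "vec_cond_exp M F Z \<in> borel_measurable F"
  using borel_measurable_vec_lambda[of "\<lambda>i. real_cond_exp M F (\<lambda>\<omega>. Z \<omega> $ i)" F]
  by (simp add: vec_cond_exp_def[abs_def])

lemma (in finite_measure_subalgebra) vec_cond_exp_integrable:
  assumes "integrable M Z"
  shows "integrable M (vec_cond_exp M F Z)"
  using assms
  by (intro integrable_vecI) (simp add: vec_cond_exp_def integrable_vec_nth real_cond_exp_int)

text \<open>The pull-out property, applied in each coordinate. Boundedness of \<open>S\<close> is
  what makes the separate products \<open>S $ i * Z $ i\<close> integrable.\<close>

lemma (in finite_measure_subalgebra) vec_cond_exp_inner: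
  fixes Z S :: "'a \<Rightarrow> real^'d"
  assumes Z: "integrable M Z" and S: "S \<in> borel_measurable F"
    and C: "AE \<omega> in M. norm (S \<omega>) \<le> C"
  shows "integrable M (\<lambda>\<omega>. vec_cond_exp M F Z \<omega> \<bullet> S \<omega>)"
    and "(\<integral>\<omega>. vec_cond_exp M F Z \<omega> \<bullet> S \<omega> \<partial>M) = (\<integral>\<omega>. Z \<omega> \<bullet> S \<omega> \<partial>M)"
proof -
  note SM[measurable] = measurable_from_subalg[OF subalg S]
  have ZM[measurable]: "Z \<in> borel_measurable M" using Z by simp
  have i: "integrable M (\<lambda>\<omega>. S \<omega> $ i * Z \<omega> $ i)" for i
  proof -
    have "integrable M (\<lambda>\<omega>. (Z \<omega> $ i) *\<^sub>R axis i 1 \<bullet> S \<omega>)"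
      by (rule integrable_inner_bounded[OF _ SM C]) (intro integrable_scaleR_left integrable_vec_nth Z)
    then show ?thesis by (simp add: inner_axis' mult.commute)
  qed
  have SF: "(\<lambda>\<omega>. S \<omega> $ i) \<in> borel_measurable F" and Zi: "(\<lambda>\<omega>. Z \<omega> $ i) \<in> borel_measurable M" for i
    using S by simp_all
  note ri = real_cond_exp_intg[OF i SF Zi]
  show "integrable M (\<lambda>\<omega>. vec_cond_exp M F Z \<omega> \<bullet> S \<omega>)"
    using ri(1) by (simp add: inner_vec_def vec_cond_exp_def mult.commute)
  show "(\<integral>\<omega>. vec_cond_exp M F Z \<omega> \<bullet> S \<omega> \<partial>M) = (\<integral>\<omega>. Z \<omega> \<bullet> S \<omega> \<partial>M)"
    using ri i by (simp add: inner_vec_def vec_cond_exp_def mult.commute)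
qed

text \<open>Continuity from below of the measure with density \<open>f\<close>.\<close>

lemma nn_integral_le_truncation:
  assumes [measurable]: "f \<in> borel_measurable M" "\<And>k. A k \<in> sets M"
    and "incseq A" "(\<Union>k. A k) = space M"
    and le: "\<And>k::nat. (\<integral>\<^sup>+\<omega>. f \<omega> * indicator (A k) \<omega> \<partial>M) \<le> C"
  shows "(\<integral>\<^sup>+\<omega>. f \<omega> \<partial>M) \<le> C"
proof -
  have "(\<integral>\<^sup>+\<omega>. f \<omega> \<partial>M) = emeasure (density M f) (space M)"
    by (subst emeasure_density) (auto intro!: nn_integral_cong)
  also have "\<dots> = (SUP k. emeasure (density M f) (A k))"
    using SUP_emeasure_incseq[of A "density M f"] assms(3,4) by (simp add: image_subset_iff)
  also have "\<dots> \<le> C"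
    using le by (intro SUP_least) (simp add: emeasure_density)
  finally show ?thesis .
qed

text \<open>Since \<open>g\<close> is \<open>G\<close>-measurable, the event where it is negative is
  itself an admissible test.\<close>

lemma AE_nonneg_of_integral_nonneg:
  fixes g :: "'a \<Rightarrow> real"
  assumes G: "subalgebra M G" and g: "g \<in> borel_measurable G" "integrable M g"
    and nonneg: "\<And>B. B \<in> sets G \<Longrightarrow> 0 \<le> (\<integral>\<omega>. indicator B \<omega> * g \<omega> \<partial>M)"
  shows "AE \<omega> in M. 0 \<le> g \<omega>"
proof -
  define B where "B = {\<omega> \<in> space G. g \<omega> < 0}"
  have B: "B \<in> sets G" unfolding B_def using g(1) by measurable
  then have [measurable]: "B \<in> sets M" using G by (auto simp: subalgebra_def)
  have int: "integrable M (\<lambda>\<omega>. - (indicator B \<omega> * g \<omega>))"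
    using integrable_mult_indicator[OF _ g(2), of B] by simp
  have ge: "0 \<le> - (indicator B \<omega> * g \<omega>)" for \<omega> by (simp add: B_def indicator_def)
  have "(\<integral>\<omega>. - (indicator B \<omega> * g \<omega>) \<partial>M) = 0"
  proof (rule antisym)
    show "0 \<le> (\<integral>\<omega>. - (indicator B \<omega> * g \<omega>) \<partial>M)"
      by (intro Bochner_Integration.integral_nonneg ge)
  qed (use nonneg[OF B] in simp)
  then have "AE \<omega> in M. - (indicator B \<omega> * g \<omega>) = 0"
    using integral_nonneg_eq_0_iff_AE[OF int] ge by simp
  then show ?thesis
    using AE_space by eventually_elim (use G in \<open>auto simp: B_def indicator_def subalgebra_def\<close>)
qed

lemma bounded_polar_sum:
  assumes "subalgebra M G" "finite I" "\<And>i. i \<in> I \<Longrightarrow> Z i \<in> bounded_polar M G A"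
  shows "(\<lambda>\<omega>. \<Sum>i\<in>I. Z i \<omega>) \<in> bounded_polar M G A"
  using assms(2,3)
proof (induction I rule: finite_induct)
  case empty
  show ?case by (simp add: bounded_polar_def)
next
  case (insert i I)
  then show ?case using bounded_polar_add[OF assms(1), of "Z i" A] by simp
qed

section \<open>Polar elements against consistent prices\<close>

context bid_ask_market begin

lemma finite_subalgebra: "t \<le> T \<Longrightarrow> finite_measure_subalgebra M (F t)"
  using sub by unfold_locales

lemma trading_cone_bounded_in_L_infty:
  assumes "t \<le> T" "\<xi> \<in> trading_cone M (F t) (\<pi> t)" "AE \<omega> in M. norm (\<xi> \<omega>) \<le> C"
  shows "\<xi> \<in> \<B> \<inter> L_infty M (F T)"
  using trading_cone_subset_attainable[OF assms(1,2)] attainable_measurable assms(3)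
  by (auto simp: L_infty_def)

text \<open>Throwing away one unit of asset \<open>i\<close> on an event \<open>B\<close> at time
  \<open>T\<close> is a bounded attainable claim.\<close>

lemma bounded_polar_nonneg:
  assumes Z: "Z \<in> bounded_polar M (F T) \<B>"
  shows "AE \<omega> in M. 0 \<le> Z \<omega> $ i"
proof (rule AE_nonneg_of_integral_nonneg[OF sub[OF le_refl]])
  fix B assume B: "B \<in> sets (F T)"
  have "(\<lambda>\<omega>. indicator B \<omega> *\<^sub>R (- axis i 1)) \<in> trading_cone M (F T) (\<pi> T)"
    using B by (intro trading_cone_scaleR trading_cone_neg_axis) auto
  moreover have "AE \<omega> in M. norm (indicator B \<omega> *\<^sub>R (- axis i (1::real))) \<le> 1"
    by (simp add: indicator_def)
  ultimately have "(\<lambda>\<omega>. indicator B \<omega> *\<^sub>R (- axis i 1)) \<in> \<B> \<inter> L_infty M (F T)"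
    using trading_cone_bounded_in_L_infty by blast
  then have "(\<integral>\<omega>. Z \<omega> \<bullet> (indicator B \<omega> *\<^sub>R (- axis i 1)) \<partial>M) \<le> 0"
    by (rule bounded_polarD[OF Z])
  then show "0 \<le> (\<integral>\<omega>. indicator B \<omega> * Z \<omega> $ i \<partial>M)"
    by (simp add: inner_axis)
qed (use Z in \<open>auto simp: bounded_polar_def intro: integrable_vec_nth\<close>)

text \<open>A trade \<open>\<xi>\<close> at time \<open>t\<close> is cut off to
  \<open>norm (\<xi> \<omega>) \<le> k\<close> and restricted to an event of \<open>F t\<close>. The
  result is still a trade at time \<open>t\<close>, now bounded and attainable, so the polar
  inequality holds for \<open>Z\<close> and passes to its conditional expectation. Varying the event
  makes it pointwise.\<close>

lemma bounded_polar_cond_exp: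
  assumes Z: "Z \<in> bounded_polar M (F T) \<B>" and t: "t \<le> T"
  shows "vec_cond_exp M (F t) Z \<in> polar_cone M (F t) (trading_cone M (F t) (\<pi> t))"
proof -
  interpret t: finite_measure_subalgebra M "F t" by (rule finite_subalgebra[OF t])
  let ?V = "vec_cond_exp M (F t) Z"
  have Zi: "integrable M Z" using Z by (simp add: bounded_polar_def)
  have V: "?V \<in> borel_measurable (F t)" by (rule t.vec_cond_exp_measurable)
  have "AE \<omega> in M. ?V \<omega> \<bullet> \<xi> \<omega> \<le> 0" if \<xi>: "\<xi> \<in> trading_cone M (F t) (\<pi> t)" for \<xi>
  proof -
    have \<xi>m: "\<xi> \<in> borel_measurable (F t)" by (rule trading_cone_measurable[OF \<xi>])
    have "AE \<omega> in M. norm (\<xi> \<omega>) \<le> real k \<longrightarrow> ?V \<omega> \<bullet> \<xi> \<omega> \<le> 0" for k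
    proof -
      define A where "A = {\<omega> \<in> space (F t). norm (\<xi> \<omega>) \<le> real k}"
      have A: "A \<in> sets (F t)" unfolding A_def using \<xi>m by measurable
      let ?\<xi>A = "\<lambda>\<omega>. indicator A \<omega> *\<^sub>R \<xi> \<omega>"
      have \<xi>A: "?\<xi>A \<in> trading_cone M (F t) (\<pi> t)"
        using A by (intro trading_cone_scaleR \<xi>) auto
      have bd: "norm (?\<xi>A \<omega>) \<le> real k" for \<omega> by (simp add: A_def indicator_def)
      have "AE \<omega> in M. 0 \<le> - (?V \<omega> \<bullet> ?\<xi>A \<omega>)"
      proof (rule AE_nonneg_of_integral_nonneg[OF sub[OF t]])
        fix B assume B: "B \<in> sets (F t)"
        let ?c = "\<lambda>\<omega>. indicator B \<omega> *\<^sub>R ?\<xi>A \<omega>"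
        have c: "?c \<in> trading_cone M (F t) (\<pi> t)"
          using B by (intro trading_cone_scaleR[OF \<xi>A]) auto
        have bdc: "AE \<omega> in M. norm (?c \<omega>) \<le> real k"
          by (intro AE_I2) (auto simp: A_def indicator_def)
        have "(\<integral>\<omega>. ?V \<omega> \<bullet> ?c \<omega> \<partial>M) = (\<integral>\<omega>. Z \<omega> \<bullet> ?c \<omega> \<partial>M)"
          by (rule t.vec_cond_exp_inner(2)[OF Zi trading_cone_measurable[OF c] bdc])
        also have "\<dots> \<le> 0"
          by (rule bounded_polarD[OF Z trading_cone_bounded_in_L_infty[OF t c bdc]])
        finally show "0 \<le> (\<integral>\<omega>. indicator B \<omega> * - (?V \<omega> \<bullet> ?\<xi>A \<omega>) \<partial>M)"
          by (simp add: mult.assoc)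
      next
        show "(\<lambda>\<omega>. - (?V \<omega> \<bullet> ?\<xi>A \<omega>)) \<in> borel_measurable (F t)"
          using V trading_cone_measurable[OF \<xi>A] by (intro borel_measurable_uminus borel_measurable_inner)
        show "integrable M (\<lambda>\<omega>. - (?V \<omega> \<bullet> ?\<xi>A \<omega>))"
          using t.vec_cond_exp_inner(1)[OF Zi trading_cone_measurable[OF \<xi>A] AE_I2[OF bd]]
          by (rule integrable_minus)
      qed
      then show ?thesis
        using AE_space
        by eventually_elim (use sub[OF t] in \<open>auto simp: A_def indicator_def subalgebra_def\<close>)
    qed
    \<comment> \<open>Countably many truncation levels share one null set, and every value of
      \<open>\<xi>\<close> is below some level.\<close>
    then have "AE \<omega> in M. \<forall>k. norm (\<xi> \<omega>) \<le> real k \<longrightarrow> ?V \<omega> \<bullet> \<xi> \<omega> \<le> 0"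
      by (subst AE_all_countable) blast
    then show ?thesis by eventually_elim (meson real_arch_simple)
  qed
  then show ?thesis
    unfolding polar_cone_def using V t.vec_cond_exp_integrable[OF Zi] by blast
qed

lemma bounded_polar_consistent:
  assumes "Z \<in> bounded_polar M (F T) \<B>" "AE \<omega> in M. \<forall>i. 0 < Z \<omega> $ i"
  shows "Z \<in> consistent_prices M F T \<pi>"
  using assms bounded_polar_cond_exp[OF assms(1)]
  by (auto simp: consistent_prices_def bounded_polar_def)

text \<open>The trades \<open>\<xi> s\<close> need not be integrable against \<open>Z\<close>. A lower bound \<open>- H\<close> on the value process is
  carried backwards in time instead, and the past position is truncated before conditioning.\<close>

lemma value_process_bound:
  fixes \<xi> :: "nat \<Rightarrow> 'a \<Rightarrow> real^'d"
  assumes Z: "integrable M Z"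
    and pol: "\<And>s. s \<le> T \<Longrightarrow> vec_cond_exp M (F s) Z \<in> polar_cone M (F s) (trading_cone M (F s) (\<pi> s))"
    and \<xi>: "\<And>s. s \<le> T \<Longrightarrow> \<xi> s \<in> trading_cone M (F s) (\<pi> s)"
    and "t \<le> T" "integrable M H" "AE \<omega> in M. 0 \<le> H \<omega>"
    and "AE \<omega> in M. 0 \<le> vec_cond_exp M (F t) Z \<omega> \<bullet> (\<Sum>s\<le>t. \<xi> s \<omega>) + H \<omega>"
  shows "(\<integral>\<^sup>+\<omega>. ennreal (vec_cond_exp M (F t) Z \<omega> \<bullet> (\<Sum>s\<le>t. \<xi> s \<omega>) + H \<omega>) \<partial>M) \<le> (\<integral>\<^sup>+\<omega>. ennreal (H \<omega>) \<partial>M)"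
  using assms(4-7)
proof (induction t arbitrary: H)
  case 0
  have "AE \<omega> in M. vec_cond_exp M (F 0) Z \<omega> \<bullet> \<xi> 0 \<omega> \<le> 0"
    by (rule polar_coneD[OF pol[OF 0(1)] \<xi>[OF 0(1)]])
  then have "AE \<omega> in M. ennreal (vec_cond_exp M (F 0) Z \<omega> \<bullet> (\<Sum>s\<le>0. \<xi> s \<omega>) + H \<omega>) \<le> ennreal (H \<omega>)"
    by eventually_elim (simp add: ennreal_leI)
  then show ?case
    by (rule nn_integral_mono_AE)
next
  case (Suc t)
  then have t: "t \<le> T" by simp
  interpret t: finite_measure_subalgebra M "F t" by (rule finite_subalgebra[OF t])
  interpret St: finite_measure_subalgebra M "F (Suc t)" by (rule finite_subalgebra[OF Suc.prems(1)])
  let ?W = "vec_cond_exp M (F (Suc t)) Z" and ?V = "vec_cond_exp M (F t) Z"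
  let ?H = "real_cond_exp M (F t) H"
  define S where "S \<omega> = (\<Sum>s\<le>t. \<xi> s \<omega>)" for \<omega>
  have St: "S \<in> borel_measurable (F t)"
    unfolding S_def
    using measurable_from_subalg[OF filt[OF _ t] trading_cone_measurable[OF \<xi>]] t
    by (intro borel_measurable_sum) auto
  note [measurable] = measurable_from_subalg[OF sub[OF t] St]
    measurable_from_subalg[OF sub[OF t] t.vec_cond_exp_measurable[of Z]]
    measurable_from_subalg[OF sub[OF Suc.prems(1)] St.vec_cond_exp_measurable[of Z]]
    borel_measurable_integrable[OF Suc.prems(2)]
  have "AE \<omega> in M. ?W \<omega> \<bullet> \<xi> (Suc t) \<omega> \<le> 0"
    by (rule polar_coneD[OF pol[OF Suc.prems(1)] \<xi>[OF Suc.prems(1)]])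
  \<comment> \<open>The last trade has nonpositive value at current prices; dropping it preserves
    the lower bound and only enlarges the integral to be estimated.\<close>
  then have le: "AE \<omega> in M. ?W \<omega> \<bullet> (\<Sum>s\<le>Suc t. \<xi> s \<omega>) + H \<omega> \<le> ?W \<omega> \<bullet> S \<omega> + H \<omega>"
    by eventually_elim (simp add: S_def inner_add_right)
  have WS: "AE \<omega> in M. 0 \<le> ?W \<omega> \<bullet> S \<omega> + H \<omega>"
    using le Suc.prems(4) by eventually_elim simp
  define A where "A k = {\<omega> \<in> space M. norm (S \<omega>) \<le> real k}" for k
  have At: "A k \<in> sets (F t)" for k
  proof -
    have "{\<omega> \<in> space (F t). norm (S \<omega>) \<le> real k} \<in> sets (F t)" using St by measurable
    then show ?thesis using sub[OF t] by (simp add: A_def subalgebra_def)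
  qed
  have A[measurable]: "A k \<in> sets M" for k unfolding A_def by measurable
  \<comment> \<open>On an \<open>F t\<close>-event inside \<open>A k\<close> the past position is
    bounded and known, so at both times the integral equals that of \<open>Z \<bullet> S + H\<close>
    over the event.\<close>
  have swap: "integrable M (\<lambda>\<omega>. indicator B \<omega> * (?V \<omega> \<bullet> S \<omega> + ?H \<omega>))"
    "integrable M (\<lambda>\<omega>. indicator B \<omega> * (?W \<omega> \<bullet> S \<omega> + H \<omega>))"
    "(\<integral>\<omega>. indicator B \<omega> * (?V \<omega> \<bullet> S \<omega> + ?H \<omega>) \<partial>M) = (\<integral>\<omega>. indicator B \<omega> * (?W \<omega> \<bullet> S \<omega> + H \<omega>) \<partial>M)"
    if B: "B \<in> sets (F t)" "B \<subseteq> A k" for B k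
  proof -
    let ?S = "\<lambda>\<omega>. indicator B \<omega> *\<^sub>R S \<omega>"
    have m: "?S \<in> borel_measurable (F t)" using St B(1) by measurable
    have m': "?S \<in> borel_measurable (F (Suc t))"
      by (rule measurable_from_subalg[OF filt[OF _ Suc.prems(1)] m]) simp
    have bd: "AE \<omega> in M. norm (?S \<omega>) \<le> real k"
      using B(2) by (intro AE_I2) (auto simp: A_def indicator_def)
    note v = t.vec_cond_exp_inner[OF Z m bd] and w = St.vec_cond_exp_inner[OF Z m' bd]
    have [measurable]: "B \<in> sets M" using B(1) sub[OF t] by (auto simp: subalgebra_def)
    have iH: "integrable M (\<lambda>\<omega>. indicator B \<omega> * H \<omega>)"
      using integrable_mult_indicator[OF _ Suc.prems(2), of B] by simp
    have iB: "indicator B \<in> borel_measurable (F t)" using B(1) by measurable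
    note h = t.real_cond_exp_intg[OF iH iB]
    show "integrable M (\<lambda>\<omega>. indicator B \<omega> * (?V \<omega> \<bullet> S \<omega> + ?H \<omega>))"
      using Bochner_Integration.integrable_add[OF v(1) h(1)] by (simp add: distrib_left)
    show "integrable M (\<lambda>\<omega>. indicator B \<omega> * (?W \<omega> \<bullet> S \<omega> + H \<omega>))"
      using Bochner_Integration.integrable_add[OF w(1) iH] by (simp add: distrib_left)
    show "(\<integral>\<omega>. indicator B \<omega> * (?V \<omega> \<bullet> S \<omega> + ?H \<omega>) \<partial>M) = (\<integral>\<omega>. indicator B \<omega> * (?W \<omega> \<bullet> S \<omega> + H \<omega>) \<partial>M)"
      using Bochner_Integration.integral_add[OF v(1) h(1)] Bochner_Integration.integral_add[OF w(1) iH]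
        v(2) w(2) h(2) by (simp add: distrib_left)
  qed
  have "AE \<omega> in M. \<forall>k. 0 \<le> indicator (A k) \<omega> * (?V \<omega> \<bullet> S \<omega> + ?H \<omega>)"
  proof (subst AE_all_countable, intro allI AE_nonneg_of_integral_nonneg[OF sub[OF t]])
    fix k B assume B: "B \<in> sets (F t)"
    have "(\<integral>\<omega>. indicator B \<omega> * (indicator (A k) \<omega> * (?V \<omega> \<bullet> S \<omega> + ?H \<omega>)) \<partial>M)
        = (\<integral>\<omega>. indicator (B \<inter> A k) \<omega> * (?V \<omega> \<bullet> S \<omega> + ?H \<omega>) \<partial>M)"
      by (simp add: indicator_inter_arith mult.assoc)
    also have "\<dots> = (\<integral>\<omega>. indicator (B \<inter> A k) \<omega> * (?W \<omega> \<bullet> S \<omega> + H \<omega>) \<partial>M)"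
      by (rule swap(3)[of _ k]) (use B At in auto)
    also have "0 \<le> \<dots>"
      by (intro integral_nonneg_AE) (use WS in \<open>eventually_elim, auto simp: indicator_def\<close>)
    finally show "0 \<le> (\<integral>\<omega>. indicator B \<omega> * (indicator (A k) \<omega> * (?V \<omega> \<bullet> S \<omega> + ?H \<omega>)) \<partial>M)" .
  next
    fix k
    show "(\<lambda>\<omega>. indicator (A k) \<omega> * (?V \<omega> \<bullet> S \<omega> + ?H \<omega>)) \<in> borel_measurable (F t)"
      using At t.vec_cond_exp_measurable[of Z] St borel_measurable_cond_exp[of M "F t" H] by measurable
    show "integrable M (\<lambda>\<omega>. indicator (A k) \<omega> * (?V \<omega> \<bullet> S \<omega> + ?H \<omega>))"
      by (rule swap(1)[OF At order_refl])
  qed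
  then have VS: "AE \<omega> in M. 0 \<le> ?V \<omega> \<bullet> S \<omega> + ?H \<omega>"
    using AE_space
  proof eventually_elim
    case (elim \<omega>)
    obtain k where "norm (S \<omega>) \<le> real k" using real_arch_simple by blast
    then show ?case using elim(1)[rule_format, of k] elim(2) by (simp add: A_def)
  qed
  \<comment> \<open>The conditioned bound \<open>?H\<close> takes the place of \<open>H\<close> at
    time \<open>t\<close>; conditioning preserves its integral, so the estimate does not deteriorate
    in the induction.\<close>
  have H0: "AE \<omega> in M. 0 \<le> ?H \<omega>"
    by (rule t.real_cond_exp_pos[OF Suc.prems(3)]) measurable
  have iH: "integrable M ?H" by (rule t.real_cond_exp_int(1)[OF Suc.prems(2)])
  have eqH: "(\<integral>\<^sup>+\<omega>. ennreal (?H \<omega>) \<partial>M) = (\<integral>\<^sup>+\<omega>. ennreal (H \<omega>) \<partial>M)"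
    by (simp add: nn_integral_eq_integral iH H0 Suc.prems(2,3) t.real_cond_exp_int(2)[OF Suc.prems(2)])
  have IH: "(\<integral>\<^sup>+\<omega>. ennreal (?V \<omega> \<bullet> S \<omega> + ?H \<omega>) \<partial>M) \<le> (\<integral>\<^sup>+\<omega>. ennreal (H \<omega>) \<partial>M)"
    unfolding eqH[symmetric] S_def by (rule Suc.IH[OF t iH H0]) (use VS in \<open>simp add: S_def\<close>)
  have "(\<integral>\<^sup>+\<omega>. ennreal (?W \<omega> \<bullet> (\<Sum>s\<le>Suc t. \<xi> s \<omega>) + H \<omega>) \<partial>M) \<le> (\<integral>\<^sup>+\<omega>. ennreal (?W \<omega> \<bullet> S \<omega> + H \<omega>) \<partial>M)"
  proof (rule nn_integral_mono_AE)
    show "AE \<omega> in M. ennreal (?W \<omega> \<bullet> (\<Sum>s\<le>Suc t. \<xi> s \<omega>) + H \<omega>) \<le> ennreal (?W \<omega> \<bullet> S \<omega> + H \<omega>)"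
      using le by eventually_elim (rule ennreal_leI)
  qed
  also have "\<dots> \<le> (\<integral>\<^sup>+\<omega>. ennreal (H \<omega>) \<partial>M)"
  proof (rule nn_integral_le_truncation[where A=A])
    show "incseq A" unfolding A_def by (auto simp: incseq_def)
    show "(\<Union>k. A k) = space M" unfolding A_def using real_arch_simple by auto
    fix k
    have "(\<integral>\<^sup>+\<omega>. ennreal (?W \<omega> \<bullet> S \<omega> + H \<omega>) * indicator (A k) \<omega> \<partial>M)
        = (\<integral>\<^sup>+\<omega>. ennreal (indicator (A k) \<omega> * (?W \<omega> \<bullet> S \<omega> + H \<omega>)) \<partial>M)"
      by (intro nn_integral_cong) (auto simp: indicator_def)
    also have "\<dots> = ennreal (\<integral>\<omega>. indicator (A k) \<omega> * (?W \<omega> \<bullet> S \<omega> + H \<omega>) \<partial>M)"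
      by (intro nn_integral_eq_integral swap(2)[OF At order_refl]) (use WS in \<open>eventually_elim, simp\<close>)
    also have "\<dots> = ennreal (\<integral>\<omega>. indicator (A k) \<omega> * (?V \<omega> \<bullet> S \<omega> + ?H \<omega>) \<partial>M)"
      by (simp only: swap(3)[OF At order_refl])
    also have "\<dots> = (\<integral>\<^sup>+\<omega>. ennreal (indicator (A k) \<omega> * (?V \<omega> \<bullet> S \<omega> + ?H \<omega>)) \<partial>M)"
      by (intro nn_integral_eq_integral[symmetric] swap(1)[OF At order_refl]) (use VS in \<open>eventually_elim, simp\<close>)
    also have "\<dots> \<le> (\<integral>\<^sup>+\<omega>. ennreal (?V \<omega> \<bullet> S \<omega> + ?H \<omega>) \<partial>M)"
      by (intro nn_integral_mono_AE) (use VS in \<open>eventually_elim, auto intro!: ennreal_leI simp: indicator_def\<close>)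
    also note IH
    finally show "(\<integral>\<^sup>+\<omega>. ennreal (?W \<omega> \<bullet> S \<omega> + H \<omega>) * indicator (A k) \<omega> \<partial>M) \<le> (\<integral>\<^sup>+\<omega>. ennreal (H \<omega>) \<partial>M)" .
  qed measurable
  finally show ?case .
qed

lemma vec_cond_exp_T:
  assumes "Z \<in> borel_measurable (F T)" "integrable M Z"
  shows "AE \<omega> in M. vec_cond_exp M (F T) Z \<omega> = Z \<omega>"
proof -
  interpret T: finite_measure_subalgebra M "F T" by (rule finite_subalgebra[OF order_refl])
  have "AE \<omega> in M. real_cond_exp M (F T) (\<lambda>\<omega>. Z \<omega> $ i) \<omega> = Z \<omega> $ i" for i
    using assms by (intro T.real_cond_exp_F_meas integrable_vec_nth) auto
  then have "AE \<omega> in M. \<forall>i. real_cond_exp M (F T) (\<lambda>\<omega>. Z \<omega> $ i) \<omega> = Z \<omega> $ i"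
    by (simp add: AE_all_countable)
  then show ?thesis
    by eventually_elim (simp add: vec_cond_exp_def vec_eq_iff)
qed

text \<open>Boundedness of \<open>X\<close> yields a lower bound \<open>- H\<close> on its terminal
  value with \<open>H = \<bar>C\<bar> * norm Z\<close> integrable. The value process bound at time
  \<open>T\<close> then reads \<open>E(Z \<bullet> X + H) \<le> E H\<close>.\<close>

lemma attainable_price_nonpos:
  assumes Z: "Z \<in> consistent_prices M F T \<pi>" and X: "X \<in> \<B>" "X \<in> L_infty M (F T)"
  shows "(\<integral>\<omega>. Z \<omega> \<bullet> X \<omega> \<partial>M) \<le> 0"
proof -
  have Zi: "integrable M Z" and ZT: "Z \<in> borel_measurable (F T)"
    and pol: "\<And>s. s \<le> T \<Longrightarrow> vec_cond_exp M (F s) Z \<in> polar_cone M (F s) (trading_cone M (F s) (\<pi> s))"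
    using Z by (auto simp: consistent_prices_def)
  obtain \<xi> where \<xi>: "\<And>t. t \<le> T \<Longrightarrow> \<xi> t \<in> trading_cone M (F t) (\<pi> t)" "AE \<omega> in M. X \<omega> = (\<Sum>t\<le>T. \<xi> t \<omega>)"
    using X(1) unfolding attainable_def by blast
  obtain C where C: "AE \<omega> in M. norm (X \<omega>) \<le> C" using X(2) by (auto simp: L_infty_def)
  define H where "H \<omega> = \<bar>C\<bar> * norm (Z \<omega>)" for \<omega>
  have Hi: "integrable M H" and H0: "0 \<le> H \<omega>" for \<omega> unfolding H_def using Zi by auto
  have int: "integrable M (\<lambda>\<omega>. Z \<omega> \<bullet> X \<omega>)"
    by (rule integrable_inner_L_infty[OF sub[OF order_refl] Zi X(2)])
  have eq: "AE \<omega> in M. vec_cond_exp M (F T) Z \<omega> \<bullet> (\<Sum>s\<le>T. \<xi> s \<omega>) + H \<omega> = Z \<omega> \<bullet> X \<omega> + H \<omega>"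
    using vec_cond_exp_T[OF ZT Zi] \<xi>(2) by eventually_elim simp
  have ge: "AE \<omega> in M. 0 \<le> Z \<omega> \<bullet> X \<omega> + H \<omega>"
    using C
  proof eventually_elim
    case (elim \<omega>)
    have "\<bar>Z \<omega> \<bullet> X \<omega>\<bar> \<le> norm (Z \<omega>) * norm (X \<omega>)" by (rule Cauchy_Schwarz_ineq2)
    also have "\<dots> \<le> norm (Z \<omega>) * \<bar>C\<bar>" using elim by (intro mult_left_mono) auto
    finally show ?case by (simp add: H_def mult.commute)
  qed
  have geV: "AE \<omega> in M. 0 \<le> vec_cond_exp M (F T) Z \<omega> \<bullet> (\<Sum>s\<le>T. \<xi> s \<omega>) + H \<omega>"
    using eq ge by eventually_elim simp
  have "ennreal (\<integral>\<omega>. Z \<omega> \<bullet> X \<omega> + H \<omega> \<partial>M) = (\<integral>\<^sup>+\<omega>. ennreal (Z \<omega> \<bullet> X \<omega> + H \<omega>) \<partial>M)"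
    using ge by (intro nn_integral_eq_integral[symmetric] Bochner_Integration.integrable_add int Hi)
  also have "\<dots> = (\<integral>\<^sup>+\<omega>. ennreal (vec_cond_exp M (F T) Z \<omega> \<bullet> (\<Sum>s\<le>T. \<xi> s \<omega>) + H \<omega>) \<partial>M)"
    by (intro nn_integral_cong_AE) (use eq in \<open>eventually_elim, simp\<close>)
  also have "\<dots> \<le> (\<integral>\<^sup>+\<omega>. ennreal (H \<omega>) \<partial>M)"
    by (rule value_process_bound[OF Zi pol \<xi>(1) order_refl Hi _ geV]) (simp_all add: H0)
  also have "\<dots> = ennreal (\<integral>\<omega>. H \<omega> \<partial>M)"
    using H0 by (intro nn_integral_eq_integral Hi) auto
  finally have "(\<integral>\<omega>. Z \<omega> \<bullet> X \<omega> + H \<omega> \<partial>M) \<le> (\<integral>\<omega>. H \<omega> \<partial>M)"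
    using H0 by (subst (asm) ennreal_le_iff) auto
  then show ?thesis
    using int Hi by simp
qed

end

section \<open>Strictly positive consistent prices\<close>

locale arbitrage_free_market = bid_ask_market M F T \<pi>
  for M :: "'a measure" and F :: "nat \<Rightarrow> 'a measure" and T :: nat and \<pi> :: "nat \<Rightarrow> 'a \<Rightarrow> real^'d^'d" +
  assumes closed: "closed_L0 M (F T) (attainable M F T \<pi>)"
    and no_arbitrage: "arbitrage_free M (attainable M F T \<pi>)"
begin

lemma bounded_polar_separation:
  assumes X: "X \<in> L_infty M (F T)" and notin: "X \<notin> \<B>"
  obtains Z where "Z \<in> bounded_polar M (F T) \<B>" "0 < (\<integral>\<omega>. Z \<omega> \<bullet> X \<omega> \<partial>M)"
proof -
  note G = sub[OF order_refl]
  have sq: "square_integrable M c" if c: "c \<in> L_infty M (F T)" for c :: "'a \<Rightarrow> real^'d"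
  proof -
    obtain C where C: "AE \<omega> in M. norm (c \<omega>) \<le> C" and "c \<in> borel_measurable (F T)"
      using c by (auto simp: L_infty_def)
    then have [measurable]: "c \<in> borel_measurable M" using measurable_from_subalg[OF G] by blast
    have "AE \<omega> in M. norm ((norm (c \<omega>))\<^sup>2) \<le> C\<^sup>2"
      using C by eventually_elim (auto intro: power_mono)
    then show ?thesis by (intro integrable_const_bound) auto
  qed
  obtain Z where Z: "Z \<in> borel_measurable (F T)" "square_integrable M Z" "0 < (\<integral>\<omega>. Z \<omega> \<bullet> X \<omega> \<partial>M)"
    "\<And>c. c \<in> \<B> \<Longrightarrow> square_integrable M c \<Longrightarrow> (\<integral>\<omega>. Z \<omega> \<bullet> c \<omega> \<partial>M) \<le> 0"
  proof (rule closed_cone_L2_separation[OF G _ closed attainable_zero attainable_add attainable_scaleR _ sq[OF X] notin])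
    show "X \<in> borel_measurable (F T)" using X by (simp add: L_infty_def)
  qed (use attainable_measurable in blast)+
  have "Z \<in> bounded_polar M (F T) \<B>"
    unfolding bounded_polar_def
    using Z(1) Z(4) sq integrable_of_square_integrable[OF measurable_from_subalg[OF G Z(1)] Z(2)]
    by blast
  then show thesis using that Z(3) by blast
qed

text \<open>One unit of asset \<open>i\<close> on \<open>E\<close> is an arbitrage, hence not
  attainable and separated from the cone. A \<open>Z\<close> whose coordinate \<open>i\<close> were
  nonpositive almost everywhere on \<open>E\<close> could not price it positively.\<close>

lemma bounded_polar_hits:
  assumes E: "E \<in> sets (F T)" "0 < measure M E"
  obtains Z where "Z \<in> bounded_polar M (F T) \<B>" "0 < measure M (E \<inter> {\<omega> \<in> space M. 0 < Z \<omega> $ i})"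
proof -
  note G = sub[OF order_refl]
  have [measurable]: "E \<in> sets M" using E(1) G by (auto simp: subalgebra_def)
  let ?X = "\<lambda>\<omega>. indicator E \<omega> *\<^sub>R axis i (1::real)"
  have XL: "?X \<in> L_infty M (F T)"
    unfolding L_infty_def using E(1) by (auto intro!: exI[of _ 1] AE_I2 simp: indicator_def)
  have "?X \<notin> \<B>"
  proof
    assume "?X \<in> \<B>"
    then have "(AE \<omega> in M. \<forall>i. 0 \<le> ?X \<omega> $ i) \<longrightarrow> (AE \<omega> in M. ?X \<omega> = 0)"
      by (rule no_arbitrage[unfolded arbitrage_free_def, THEN bspec])
    then have "AE \<omega> in M. ?X \<omega> = 0"
      by (rule mp) (simp add: axis_def)
    then have "AE \<omega> in M. \<omega> \<notin> E"
      by eventually_elim (auto simp: indicator_def axis_eq_0_iff split: if_splits)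
    then show False using E(2) AE_iff_null_sets[of E M] measure_eq_0_null_sets by fastforce
  qed
  then obtain Z where Z: "Z \<in> bounded_polar M (F T) \<B>" "0 < (\<integral>\<omega>. Z \<omega> \<bullet> ?X \<omega> \<partial>M)"
    using bounded_polar_separation[OF XL] by blast
  have [measurable]: "Z \<in> borel_measurable M"
    using Z(1) measurable_from_subalg[OF G] by (auto simp: bounded_polar_def)
  have "measure M (E \<inter> {\<omega> \<in> space M. 0 < Z \<omega> $ i}) \<noteq> 0"
  proof
    assume "measure M (E \<inter> {\<omega> \<in> space M. 0 < Z \<omega> $ i}) = 0"
    then have "E \<inter> {\<omega> \<in> space M. 0 < Z \<omega> $ i} \<in> null_sets M"
      by (intro null_setsI) (auto simp: emeasure_eq_measure)
    then have "AE \<omega> in M. \<omega> \<notin> E \<inter> {\<omega> \<in> space M. 0 < Z \<omega> $ i}"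
      by (rule AE_not_in)
    then have "AE \<omega> in M. Z \<omega> \<bullet> ?X \<omega> \<le> 0"
      using AE_space by eventually_elim (auto simp: indicator_def inner_axis)
    then have "AE \<omega> in M. 0 \<le> - (Z \<omega> \<bullet> ?X \<omega>)" by eventually_elim simp
    then have "0 \<le> (\<integral>\<omega>. - (Z \<omega> \<bullet> ?X \<omega>) \<partial>M)" by (rule integral_nonneg_AE)
    then show False using Z(2) by simp
  qed
  then show thesis using that[OF Z(1)] by (simp add: zero_less_measure_iff)
qed

text \<open>The exhaustion runs over the positivity sets of coordinate \<open>i\<close>. Countably
  many of them are covered by that of one weighted series, because coordinates of polar elements are
  nonnegative and nothing cancels.\<close>

lemma strictly_positive_coordinate:
  obtains Z where "Z \<in> bounded_polar M (F T) \<B>" "AE \<omega> in M. 0 < Z \<omega> $ i"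
proof -
  note G = sub[OF order_refl]
  let ?P = "bounded_polar M (F T) \<B>"
  let ?pos = "\<lambda>Z :: 'a \<Rightarrow> real^'d. {\<omega> \<in> space M. 0 < Z \<omega> $ i}"
  have "\<exists>S\<in>?pos ` ?P. AE \<omega> in M. \<omega> \<in> S"
  proof (rule exhaustion[OF G])
    show "?pos ` ?P \<subseteq> sets (F T)"
    proof
      fix S assume "S \<in> ?pos ` ?P"
      then obtain Z where Z: "Z \<in> borel_measurable (F T)" "S = ?pos Z" by (auto simp: bounded_polar_def)
      have "{\<omega> \<in> space (F T). 0 < Z \<omega> $ i} \<in> sets (F T)" using Z(1) by measurable
      then show "S \<in> sets (F T)" using Z(2) G by (simp add: subalgebra_def)
    qed
    show "?pos ` ?P \<noteq> {}"
      \<comment> \<open>The empty sum is the zero price vector, so the family contains at least the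
        empty set.\<close>
      using bounded_polar_sum[OF G, of "{}"] by auto
    show "\<exists>S\<in>?pos ` ?P. 0 < measure M (E \<inter> S)" if "E \<in> sets (F T)" "0 < measure M E" for E
      using bounded_polar_hits[OF that, of i] by blast
  next
    fix S :: "nat \<Rightarrow> 'a set" assume "\<And>k. S k \<in> ?pos ` ?P"
    then obtain Z where Z: "\<And>k. Z k \<in> ?P" "\<And>k. S k = ?pos (Z k)"
      unfolding image_iff by metis
    \<comment> \<open>Positive weights that make the series of first moments geometric; the 1 keeps
      the denominator positive when \<open>Z k\<close> vanishes.\<close>
    define a where "a k = (1/2)^k / (1 + (\<integral>\<omega>. norm (Z k \<omega>) \<partial>M))" for k
    have a: "0 < a k" "a k * (\<integral>\<omega>. norm (Z k \<omega>) \<partial>M) \<le> (1/2)^k" for k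
    proof -
      let ?I = "\<integral>\<omega>. norm (Z k \<omega>) \<partial>M"
      have I: "0 \<le> ?I" by simp
      then have "0 < 1 + ?I" by linarith
      then show "0 < a k" by (simp only: a_def) (intro divide_pos_pos, auto)
      have "?I / (1 + ?I) \<le> 1" using I by (subst divide_le_eq_1_pos) linarith+
      then have "(1/2)^k * (?I / (1 + ?I)) \<le> (1/2)^k"
        by (intro mult_left_le) auto
      then show "a k * ?I \<le> (1/2)^k"
        by (simp add: a_def)
    qed
    let ?Z = "\<lambda>k \<omega>. a k *\<^sub>R Z k \<omega>"
    have aZ: "?Z k \<in> ?P" for k
      using bounded_polar_scaleR[OF Z(1), of "a k"] a(1)[of k] by simp
    have sum: "summable (\<lambda>k. \<integral>\<omega>. norm (?Z k \<omega>) \<partial>M)"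
      by (rule summable_comparison_test'[OF summable_geometric[of "1/2"], where N=0])
        (use a in \<open>auto simp: less_imp_le\<close>)
    have int: "integrable M (?Z k)" for k using aZ[of k] by (simp only: bounded_polar_def mem_Collect_eq)
    have nonneg: "AE \<omega> in M. \<forall>k. 0 \<le> Z k \<omega> $ i"
      using bounded_polar_nonneg[OF Z(1)] by (subst AE_all_countable) blast
    have "AE \<omega> in M. \<forall>k. 0 < Z k \<omega> $ i \<longrightarrow> 0 < (\<Sum>k. ?Z k \<omega>) $ i"
      using AE_summable_norm[OF int sum] nonneg
    proof eventually_elim
      case (elim \<omega>)
      have sm: "summable (\<lambda>k. ?Z k \<omega>)" using elim(1) by (rule summable_norm_cancel)
      have eq: "(\<Sum>k. ?Z k \<omega>) $ i = (\<Sum>k. ?Z k \<omega> $ i)"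
        by (rule bounded_linear.suminf[OF bounded_linear_vec_nth sm])
      have sm': "summable (\<lambda>k. ?Z k \<omega> $ i)"
        by (rule bounded_linear.summable[OF bounded_linear_vec_nth sm])
      show ?case
        unfolding eq
      proof (intro allI impI)
        fix k assume "0 < Z k \<omega> $ i"
        then show "0 < (\<Sum>k. ?Z k \<omega> $ i)"
          using elim(2) a(1) by (intro suminf_pos2[OF sm', of k]) (auto simp: less_imp_le)
      qed
    qed
    then have covers: "AE \<omega> in M. \<omega> \<in> S k \<longrightarrow> \<omega> \<in> ?pos (\<lambda>\<omega>. \<Sum>k. ?Z k \<omega>)" for k
      unfolding Z(2) by eventually_elim auto
    show "\<exists>U\<in>?pos ` ?P. \<forall>k. AE \<omega> in M. \<omega> \<in> S k \<longrightarrow> \<omega> \<in> U"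
      by (rule bexI[OF _ imageI[OF bounded_polar_suminf[OF G aZ sum]]]) (intro allI covers)
  qed
  then obtain Z where Z: "Z \<in> ?P" "AE \<omega> in M. \<omega> \<in> ?pos Z"
    by (elim bexE imageE) (simp only:)
  from Z(2) have "AE \<omega> in M. 0 < Z \<omega> $ i" by eventually_elim simp
  then show thesis by (rule that[OF Z(1)])
qed

text \<open>Add one polar element per asset, each positive in its own coordinate and nonnegative in
  the others.\<close>

lemma strictly_positive_polar:
  obtains Z where "Z \<in> bounded_polar M (F T) \<B>" "AE \<omega> in M. \<forall>i. 0 < Z \<omega> $ i"
proof -
  have "\<forall>i. \<exists>Z. Z \<in> bounded_polar M (F T) \<B> \<and> (AE \<omega> in M. 0 < Z \<omega> $ i)"
  proof
    fix i
    obtain Z where "Z \<in> bounded_polar M (F T) \<B>" "AE \<omega> in M. 0 < Z \<omega> $ i"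
      by (rule strictly_positive_coordinate)
    then show "\<exists>Z. Z \<in> bounded_polar M (F T) \<B> \<and> (AE \<omega> in M. 0 < Z \<omega> $ i)"
      by (intro exI conjI)
  qed
  from choice[OF this] obtain Z
    where "\<forall>i. Z i \<in> bounded_polar M (F T) \<B> \<and> (AE \<omega> in M. 0 < Z i \<omega> $ i)" ..
  then have Z: "Z i \<in> bounded_polar M (F T) \<B>" "AE \<omega> in M. 0 < Z i \<omega> $ i" for i
    by (simp_all only:)
  have pos: "AE \<omega> in M. \<forall>i. 0 < Z i \<omega> $ i"
    using Z(2) by (subst AE_all_countable) blast
  have nonneg: "AE \<omega> in M. \<forall>i j. 0 \<le> Z i \<omega> $ j"
    using bounded_polar_nonneg[OF Z(1)] by (simp add: AE_all_countable)
  have "AE \<omega> in M. \<forall>j. 0 < (\<Sum>i\<in>UNIV. Z i \<omega>) $ j"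
    using pos nonneg
  proof eventually_elim
    case (elim \<omega>)
    have "0 < (\<Sum>i\<in>UNIV. Z i \<omega> $ j)" for j
      using elim by (intro sum_pos2[of _ j]) auto
    then show ?case by simp
  qed
  moreover have "(\<lambda>\<omega>. \<Sum>i\<in>UNIV. Z i \<omega>) \<in> bounded_polar M (F T) \<B>"
    by (intro bounded_polar_sum[OF sub] order_refl Z finite)
  ultimately show thesis
    by (intro that)
qed

lemma attainable_if_prices_nonpos:
  assumes X: "X \<in> L_infty M (F T)"
    and nonpos: "\<And>Z. Z \<in> consistent_prices M F T \<pi> \<Longrightarrow> (\<integral>\<omega>. Z \<omega> \<bullet> X \<omega> \<partial>M) \<le> 0"
  shows "X \<in> \<B>"
proof (rule ccontr)
  assume "X \<notin> \<B>"
  then obtain Z where Z: "Z \<in> bounded_polar M (F T) \<B>" "0 < (\<integral>\<omega>. Z \<omega> \<bullet> X \<omega> \<partial>M)"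
    using bounded_polar_separation[OF X] by blast
  obtain W where W: "W \<in> bounded_polar M (F T) \<B>" "AE \<omega> in M. \<forall>i. 0 < W \<omega> $ i"
    using strictly_positive_polar .
  note G = sub[OF order_refl]
  let ?x = "\<integral>\<omega>. Z \<omega> \<bullet> X \<omega> \<partial>M" and ?y = "\<integral>\<omega>. W \<omega> \<bullet> X \<omega> \<partial>M"
  \<comment> \<open>\<open>Z + s W\<close> is consistent for every \<open>s > 0\<close>; as
    \<open>s\<close> tends to 0, the price inequality passes to \<open>Z\<close> itself, against its
    choice.\<close>
  have "0 \<le> - ?x"
  proof (rule nonneg_of_affine_nonneg)
    fix s :: real assume s: "0 < s"
    have nonneg: "AE \<omega> in M. \<forall>i. 0 \<le> Z \<omega> $ i"
      using bounded_polar_nonneg[OF Z(1)] by (subst AE_all_countable) blast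
    have "AE \<omega> in M. \<forall>i. 0 < (Z \<omega> + s *\<^sub>R W \<omega>) $ i"
      using nonneg W(2) by eventually_elim (use s in \<open>auto intro!: add_nonneg_pos\<close>)
    then have "(\<lambda>\<omega>. Z \<omega> + s *\<^sub>R W \<omega>) \<in> consistent_prices M F T \<pi>"
      using s by (intro bounded_polar_consistent bounded_polar_add[OF G] Z(1) bounded_polar_scaleR W(1)) auto
    then have "(\<integral>\<omega>. (Z \<omega> + s *\<^sub>R W \<omega>) \<bullet> X \<omega> \<partial>M) \<le> 0" by (rule nonpos)
    moreover have "integrable M (\<lambda>\<omega>. Z \<omega> \<bullet> X \<omega>)" "integrable M (\<lambda>\<omega>. W \<omega> \<bullet> X \<omega>)"
      using Z(1) W(1) by (auto intro!: integrable_inner_L_infty[OF G _ X] simp: bounded_polar_def)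
    ultimately show "0 \<le> - ?x + s * - ?y" by (simp add: inner_add_left)
  qed
  then show False using Z(2) by simp
qed

lemma attainable_iff_prices_nonpos:
  assumes "X \<in> L_infty M (F T)"
  shows "X \<in> \<B> \<longleftrightarrow> (\<forall>Z\<in>consistent_prices M F T \<pi>. (\<integral>\<omega>. Z \<omega> \<bullet> X \<omega> \<partial>M) \<le> 0)"
proof (intro iffI ballI)
  show "(\<integral>\<omega>. Z \<omega> \<bullet> X \<omega> \<partial>M) \<le> 0" if "X \<in> \<B>" "Z \<in> consistent_prices M F T \<pi>" for Z
    using attainable_price_nonpos[OF that(2,1) assms] .
  show "X \<in> \<B>" if "\<forall>Z\<in>consistent_prices M F T \<pi>. (\<integral>\<omega>. Z \<omega> \<bullet> X \<omega> \<partial>M) \<le> 0"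
    by (rule attainable_if_prices_nonpos[OF assms bspec[OF that]])
qed

end

section \<open>The extra period\<close>

text \<open>The vertices of a cube of dimension \<open>d - 1\<close>: \<open>PiE\<close> pins the
  value at \<open>n\<close> to \<open>undefined\<close>, so no vertex is counted twice.\<close>

abbreviation coin_space :: "'d::finite \<Rightarrow> ('d \<Rightarrow> nat) set" where
  "coin_space n \<equiv> PiE (UNIV - {n}) (\<lambda>_. {0, 1})"

lemma finite_coin_space: "finite (coin_space n)"
  by (intro finite_PiE) auto

lemma card_coin_space: "card (coin_space (n :: 'd::finite)) = 2 ^ (CARD('d) - 1)"
  by (simp add: card_PiE card_Diff_singleton numeral_2_eq_2)

lemma coin_space_nonempty: "coin_space n \<noteq> {}"
  by (simp add: PiE_eq_empty_iff)

lemma prob_space_extra_space: "prob_space (extra_space n)"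
  unfolding extra_space_def
  by (rule prob_space_uniform_count_measure[OF finite_coin_space coin_space_nonempty])

lemma space_extra_space: "space (extra_space n) = coin_space n"
  by (simp add: extra_space_def space_uniform_count_measure)

text \<open>The coin factor is finite and all its subsets are measurable, so measurability may be
  checked on each section.\<close>

lemma measurable_ext_measure:
  assumes "\<And>w. w \<in> coin_space n \<Longrightarrow> (\<lambda>\<omega>. h (\<omega>, w)) \<in> borel_measurable M"
  shows "h \<in> borel_measurable (ext_measure M n)"
proof -
  have eq: "sets (ext_measure M n) = sets (M \<Otimes>\<^sub>M count_space (coin_space n))"
    unfolding ext_measure_def
    by (intro sets_pair_measure_cong refl) (simp add: extra_space_def sets_uniform_count_measure)
  have "(\<lambda>x. h (fst x, snd x)) \<in> borel_measurable (M \<Otimes>\<^sub>M count_space (coin_space n))"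
  proof (rule measurable_compose_countable'[where f="\<lambda>w x. h (fst x, w)" and g=snd and I="coin_space n"])
    show "(\<lambda>x. h (fst x, w)) \<in> borel_measurable (M \<Otimes>\<^sub>M count_space (coin_space n))"
      if "w \<in> coin_space n" for w
      by (rule measurable_compose[OF measurable_fst assms[OF that]])
  qed (intro measurable_snd countable_finite finite_coin_space)+
  then show ?thesis
    by (simp only: measurable_cong_sets[OF eq refl] prod.collapse)
qed

lemma AE_ext_measure:
  assumes "prob_space M" and P: "AE \<omega> in M. \<forall>w\<in>coin_space n. P (\<omega>, w)"
    and "{x \<in> space (ext_measure M n). P x} \<in> sets (ext_measure M n)"
  shows "AE x in ext_measure M n. P x"
proof -
  interpret prob_space M by fact
  interpret E: prob_space "extra_space n" by (rule prob_space_extra_space)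
  interpret pair_sigma_finite M "extra_space n" ..
  show ?thesis
    unfolding ext_measure_def
  proof (rule AE_pair_measure)
    show "{x \<in> space (M \<Otimes>\<^sub>M extra_space n). P x} \<in> sets (M \<Otimes>\<^sub>M extra_space n)"
      using assms(3) by (simp only: ext_measure_def)
    show "AE x in M. AE y in extra_space n. P (x, y)"
      using P by eventually_elim (auto intro!: AE_I2 simp: space_extra_space)
  qed
qed

lemma integral_ext_measure:
  fixes h :: "'a \<times> ('d::finite \<Rightarrow> nat) \<Rightarrow> real"
  assumes "prob_space M" and int: "\<And>w. w \<in> coin_space n \<Longrightarrow> integrable M (\<lambda>\<omega>. h (\<omega>, w))"
  shows "(\<integral>x. h x \<partial>ext_measure M n) = (\<Sum>w\<in>coin_space n. \<integral>\<omega>. h (\<omega>, w) \<partial>M) / 2 ^ (CARD('d) - 1)"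
proof -
  interpret prob_space M by fact
  interpret E: prob_space "extra_space n" by (rule prob_space_extra_space)
  interpret pair_sigma_finite M "extra_space n" ..
  have E: "(\<integral>w. g w \<partial>extra_space n) = (\<Sum>w\<in>coin_space n. g w) / 2 ^ (CARD('d) - 1)"
    for g :: "('d \<Rightarrow> nat) \<Rightarrow> real"
    unfolding extra_space_def
    by (subst integral_uniform_count_measure[OF finite_coin_space]) (simp only: card_coin_space of_nat_power of_nat_numeral)
  have "h \<in> borel_measurable (ext_measure M n)"
    using int by (intro measurable_ext_measure borel_measurable_integrable)
  then have "integrable (M \<Otimes>\<^sub>M extra_space n) h"
  proof (intro Fubini_integrable)
    show "integrable M (\<lambda>\<omega>. \<integral>w. norm (h (\<omega>, w)) \<partial>extra_space n)"
      unfolding E using int by auto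
    show "AE \<omega> in M. integrable (extra_space n) (\<lambda>w. h (\<omega>, w))"
      unfolding extra_space_def uniform_count_measure_def
      by (intro AE_I2 integrable_point_measure_finite finite_coin_space)
  qed (simp add: ext_measure_def)
  then have "(\<integral>x. h x \<partial>ext_measure M n) = (\<integral>\<omega>. \<integral>w. h (\<omega>, w) \<partial>extra_space n \<partial>M)"
    unfolding ext_measure_def by (rule integral_fst'[symmetric])
  also have "\<dots> = (\<Sum>w\<in>coin_space n. \<integral>\<omega>. h (\<omega>, w) \<partial>M) / 2 ^ (CARD('d) - 1)"
    unfolding E using int by simp
  finally show ?thesis .
qed

text \<open>The expectation of a function of coordinate \<open>j\<close> under independent coins
  with success probabilities \<open>\<theta> i\<close>. As an algebraic identity it holds for all
  real \<open>\<theta>\<close>: with \<open>g\<close> absorbed into factor \<open>j\<close>, the sum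
  factorizes and every other factor is 1.\<close>

lemma sum_prod_bernoulli:
  fixes \<theta> g :: "_ \<Rightarrow> real"
  assumes "finite I" "j \<in> I"
  shows "(\<Sum>w\<in>PiE I (\<lambda>_. {0, 1}). (\<Prod>i\<in>I. \<theta> i ^ w i * (1 - \<theta> i) ^ (1 - w i)) * g (w j))
    = \<theta> j * g (1::nat) + (1 - \<theta> j) * g 0"
proof -
  have "(\<Sum>w\<in>PiE I (\<lambda>_. {0, 1}). (\<Prod>i\<in>I. \<theta> i ^ w i * (1 - \<theta> i) ^ (1 - w i)) * g (w j))
    = (\<Sum>w\<in>PiE I (\<lambda>_. {0, 1}). \<Prod>i\<in>I. (\<theta> i ^ w i * (1 - \<theta> i) ^ (1 - w i)) * (if i = j then g (w i) else 1))"
    using assms by (simp add: prod.distrib prod.delta)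
  also have "\<dots> = (\<Prod>i\<in>I. \<Sum>y\<in>{0, 1}. (\<theta> i ^ y * (1 - \<theta> i) ^ (1 - y)) * (if i = j then g y else 1))"
    by (rule prod_sum_PiE[symmetric]) (use assms in auto)
  also have "\<dots> = (\<Prod>i\<in>I. if i = j then \<theta> j * g 1 + (1 - \<theta> j) * g 0 else 1)"
    by (intro prod.cong) auto
  also have "\<dots> = \<theta> j * g 1 + (1 - \<theta> j) * g 0"
    using assms by (simp add: prod.delta)
  finally show ?thesis .
qed

lemma sum_prod_bernoulli_1:
  fixes \<theta> :: "_ \<Rightarrow> real"
  assumes "finite I"
  shows "(\<Sum>w\<in>PiE I (\<lambda>_. {0, 1}). \<Prod>i\<in>I. \<theta> i ^ w i * (1 - \<theta> i) ^ (1 - w i :: nat)) = 1"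
proof -
  have "(\<Sum>w\<in>PiE I (\<lambda>_. {0, 1}). \<Prod>i\<in>I. \<theta> i ^ w i * (1 - \<theta> i) ^ (1 - w i))
      = (\<Prod>i\<in>I. \<Sum>y\<in>{0, 1::nat}. \<theta> i ^ y * (1 - \<theta> i) ^ (1 - y))"
    by (rule prod_sum_PiE[symmetric]) (use assms in auto)
  also have "\<dots> = (\<Prod>i\<in>I. 1)"
    by (intro prod.cong) auto
  finally show ?thesis by simp
qed

lemma final_price_nth:
  "final_price p n \<epsilon> (\<omega>, w) $ j = (if j = n then 1 else
     (1 - real (w j)) * (1 - \<epsilon>) * sell p n j \<omega> + real (w j) * (1 + \<epsilon>) * buy p n j \<omega>)"
  by (simp add: final_price_def axis_def if_distrib sum.delta cong: if_cong)

text \<open>The algebra of the extra period at one scenario \<open>\<omega>\<close>.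
  \<open>Z_le\<close> says that no exchange at terminal rates gains value under \<open>Z\<close>,
  which holds off a null set for consistent prices.\<close>

locale extra_period_point =
  fixes p :: "'a \<Rightarrow> real^'d^'d" and n :: 'd and \<epsilon> :: real and Z :: "'a \<Rightarrow> real^'d" and \<omega> :: 'a
  assumes \<epsilon>: "0 < \<epsilon>"
    and p_pos: "\<And>i j. 0 < p \<omega> $ i $ j"
    and Z_pos: "\<And>i. 0 < Z \<omega> $ i"
    and Z_le: "\<And>i j. Z \<omega> $ j \<le> p \<omega> $ i $ j * Z \<omega> $ i"
begin

abbreviation "z j \<equiv> Z \<omega> $ j / Z \<omega> $ n"
abbreviation "s j \<equiv> sell p n j \<omega>"
abbreviation "b j \<equiv> buy p n j \<omega>"
abbreviation "\<theta> j \<equiv> theta p n \<epsilon> Z \<omega> j"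
abbreviation "wt w \<equiv> lambda_weight p n \<epsilon> Z \<omega> w"
abbreviation "Y w \<equiv> final_price p n \<epsilon> (\<omega>, w)"

text \<open>\<open>Z_le\<close> for exchanges out of and into the numeraire puts the relative price
  between bid and ask.\<close>

lemma price_bounds: "0 < s j" "s j \<le> z j" "z j \<le> b j" "0 < z j"
  using p_pos[of j n] p_pos[of n j] Z_pos[of j] Z_pos[of n] Z_le[of n j] Z_le[of j n]
  by (simp_all add: sell_def buy_def field_simps)

lemma spread_pos: "0 < b j * (1 + \<epsilon>) - s j * (1 - \<epsilon>)"
proof -
  have "0 < b j * \<epsilon>" "0 < s j * \<epsilon>" using price_bounds[of j] \<epsilon> by auto
  then show ?thesis using price_bounds[of j] by (simp add: algebra_simps)
qed

lemma theta_bounds: "0 \<le> \<theta> j" "\<theta> j \<le> 1"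
proof -
  have "0 < b j * \<epsilon>" "0 < s j * \<epsilon>" using price_bounds[of j] \<epsilon> by auto
  then show "0 \<le> \<theta> j" "\<theta> j \<le> 1"
    unfolding theta_def using spread_pos[of j] price_bounds[of j]
    by (auto simp: algebra_simps intro!: divide_nonneg_pos)
qed

text \<open>\<open>theta\<close> is the unique weight giving the two-point law on the widened prices
  the mean \<open>z j\<close>.\<close>

lemma theta_mean: "\<theta> j * ((1 + \<epsilon>) * b j) + (1 - \<theta> j) * ((1 - \<epsilon>) * s j) = z j"
proof -
  have "\<theta> j * (b j * (1 + \<epsilon>) - s j * (1 - \<epsilon>)) = z j - s j * (1 - \<epsilon>)"
    unfolding theta_def using spread_pos[of j] by simp
  then show ?thesis by (simp add: algebra_simps)
qed

lemma lambda_weight_nonneg: "0 \<le> wt w"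
  unfolding lambda_weight_def using theta_bounds by (intro prod_nonneg) auto

lemma sum_lambda_weight_price: "(\<Sum>w\<in>coin_space n. wt w * Y w $ j) = z j"
proof (cases "j = n")
  case True
  then show ?thesis
    using sum_prod_bernoulli_1[of "UNIV - {n}" "\<theta>"] Z_pos[of n]
    by (simp add: final_price_nth lambda_weight_def)
next
  case False
  then show ?thesis
    using sum_prod_bernoulli[of "UNIV - {n}" j "\<theta>" "\<lambda>y. (1 - real y) * (1 - \<epsilon>) * s j + real y * (1 + \<epsilon>) * b j"]
      theta_mean[of j]
    by (simp add: final_price_nth lambda_weight_def mult.assoc)
qed

text \<open>For \<open>\<epsilon> > 1\<close> the lower final price is negative, so the mean alone does not bound the summands.\<close>

lemma lambda_weight_price_bound:
  assumes "w \<in> coin_space n"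
  shows "wt w * \<bar>Y w $ j\<bar> \<le> (1 + 2 * \<bar>1 - \<epsilon>\<bar>) * z j"
proof -
  have "wt w * \<bar>Y w $ j\<bar> \<le> (\<Sum>w\<in>coin_space n. wt w * \<bar>Y w $ j\<bar>)"
    by (intro member_le_sum[of w "coin_space n" "\<lambda>w. wt w * \<bar>Y w $ j\<bar>"] assms finite_coin_space
        mult_nonneg_nonneg lambda_weight_nonneg abs_ge_zero)
  also have "\<dots> \<le> (1 + 2 * \<bar>1 - \<epsilon>\<bar>) * z j"
  proof (cases "j = n")
    case True
    then show ?thesis
      using sum_prod_bernoulli_1[of "UNIV - {n}" "\<theta>"] Z_pos[of n]
      by (simp add: final_price_nth lambda_weight_def)
  next
    case False
    let ?g = "\<lambda>y. \<bar>(1 - real y) * (1 - \<epsilon>) * s j + real y * (1 + \<epsilon>) * b j\<bar>"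
    have "(\<Sum>w\<in>coin_space n. wt w * \<bar>Y w $ j\<bar>) = \<theta> j * ?g 1 + (1 - \<theta> j) * ?g 0"
      using sum_prod_bernoulli[of "UNIV - {n}" j "\<theta>" ?g] False
      by (simp add: final_price_nth lambda_weight_def)
    also have "\<dots> = \<theta> j * ((1 + \<epsilon>) * b j) + (1 - \<theta> j) * (\<bar>1 - \<epsilon>\<bar> * s j)"
      using price_bounds[of j] \<epsilon> by (simp add: abs_mult)
    \<comment> \<open>The mean is split off; the correction for the sign of the lower price is at
      most \<open>2 * \<bar>1 - \<epsilon>\<bar> * s j\<close>, and
      \<open>s j \<le> z j\<close>.\<close>
    also have "\<dots> = z j + (1 - \<theta> j) * ((\<bar>1 - \<epsilon>\<bar> - (1 - \<epsilon>)) * s j)"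
      using theta_mean[of j] by (simp add: algebra_simps)
    also have "(1 - \<theta> j) * ((\<bar>1 - \<epsilon>\<bar> - (1 - \<epsilon>)) * s j) \<le> 1 * ((2 * \<bar>1 - \<epsilon>\<bar>) * z j)"
      using theta_bounds[of j] price_bounds[of j] by (intro mult_mono) auto
    finally show ?thesis by (simp add: algebra_simps)
  qed
  finally show ?thesis .
qed

end

section \<open>Expectations under the pricing measures\<close>

lemma (in prob_space) expectation_pos:
  assumes "integrable M f" "AE \<omega> in M. 0 < f \<omega>"
  shows "0 < (\<integral>\<omega>. f \<omega> \<partial>M :: real)"
proof -
  have nonneg: "AE \<omega> in M. 0 \<le> f \<omega>" using assms(2) by eventually_elim simp
  have "(\<integral>\<omega>. f \<omega> \<partial>M) \<noteq> 0"
  proof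
    assume "(\<integral>\<omega>. f \<omega> \<partial>M) = 0"
    then have "AE \<omega> in M. f \<omega> = 0"
      using integral_nonneg_eq_0_iff_AE[OF assms(1) nonneg] by simp
    then have "AE \<omega> in M. False" using assms(2) by eventually_elim simp
    then show False by simp
  qed
  moreover have "0 \<le> (\<integral>\<omega>. f \<omega> \<partial>M)" using nonneg by (rule integral_nonneg_AE)
  ultimately show ?thesis by linarith
qed

text \<open>On an event of probability 0 or 1, integrating \<open>f\<close> or its mean gives the
  same result, which characterizes the conditional expectation.\<close>

lemma real_cond_exp_trivial:
  fixes f :: "'a \<Rightarrow> real"
  assumes "prob_space M" "subalgebra M G" and triv: "\<forall>A\<in>sets G. measure M A = 0 \<or> measure M A = 1"
    and f: "integrable M f"
  shows "AE \<omega> in M. real_cond_exp M G f \<omega> = (\<integral>\<omega>. f \<omega> \<partial>M)"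
proof -
  interpret prob_space M by fact
  interpret finite_measure_subalgebra M G by unfold_locales fact
  have [measurable]: "f \<in> borel_measurable M" using f by simp
  show ?thesis
  proof (rule real_cond_exp_charact)
    fix A assume A: "A \<in> sets G"
    then have [measurable]: "A \<in> sets M" using assms(2) by (auto simp: subalgebra_def)
    consider "measure M A = 0" | "measure M A = 1" using triv A by blast
    then show "(\<integral>\<omega>\<in>A. f \<omega> \<partial>M) = (\<integral>\<omega>\<in>A. (\<integral>\<omega>. f \<omega> \<partial>M) \<partial>M)"
    proof cases
      case 1
      then have "A \<in> null_sets M" by (intro null_setsI) (auto simp: emeasure_eq_measure)
      then have ae: "AE \<omega> in M. \<omega> \<notin> A" by (rule AE_not_in)
      have "(\<integral>\<omega>. indicator A \<omega> *\<^sub>R g \<omega> \<partial>M) = 0" for g :: "'a \<Rightarrow> real"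
        by (rule integral_eq_zero_AE) (use ae in \<open>eventually_elim, simp\<close>)
      then show ?thesis using 1 by (simp add: set_lebesgue_integral_def)
    next
      case 2
      then have ae: "AE \<omega> in M. \<omega> \<in> A" by (subst (asm) prob_eq_1) auto
      have "(\<integral>\<omega>\<in>A. f \<omega> \<partial>M) = (\<integral>\<omega>. f \<omega> \<partial>M)"
        unfolding set_lebesgue_integral_def
        by (rule integral_cong_AE) (measurable, use ae in \<open>eventually_elim, simp\<close>)
      then show ?thesis using 2 by (simp add: set_lebesgue_integral_def)
    qed
  qed (use f in auto)
qed

lemma final_price_measurable:
  assumes "p \<in> borel_measurable M"
  shows "(\<lambda>\<omega>. final_price p n \<epsilon> (\<omega>, w)) \<in> borel_measurable M"
  unfolding final_price_def buy_def sell_def prod.case using assms by measurable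

lemma lambda_weight_measurable:
  assumes "p \<in> borel_measurable M" "Z \<in> borel_measurable M"
  shows "(\<lambda>\<omega>. lambda_weight p n \<epsilon> Z \<omega> w) \<in> borel_measurable M"
  unfolding lambda_weight_def theta_def buy_def sell_def using assms by measurable

context bid_ask_market begin

lemma extra_period_point_AE:
  assumes Z: "Z \<in> consistent_prices M F T \<pi>" and \<epsilon>: "0 < \<epsilon>"
  shows "AE \<omega> in M. extra_period_point (\<pi> T) \<epsilon> Z \<omega>"
proof -
  have Zi: "integrable M Z" and ZT: "Z \<in> borel_measurable (F T)" and pos: "AE \<omega> in M. \<forall>i. 0 < Z \<omega> $ i"
    and pol: "vec_cond_exp M (F T) Z \<in> polar_cone M (F T) (trading_cone M (F T) (\<pi> T))"
    using Z by (auto simp: consistent_prices_def)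
  have le: "AE \<omega> in M. Z \<omega> $ j \<le> \<pi> T \<omega> $ i $ j * Z \<omega> $ i" for i j
  proof -
    have "(\<lambda>\<omega>. axis j 1 - \<pi> T \<omega> $ i $ j *\<^sub>R axis i 1) \<in> trading_cone M (F T) (\<pi> T)"
      by (rule trading_cone_exchange[OF \<pi>_measurable[OF order_refl]])
    from polar_coneD[OF pol this]
    have "AE \<omega> in M. vec_cond_exp M (F T) Z \<omega> \<bullet> (axis j 1 - \<pi> T \<omega> $ i $ j *\<^sub>R axis i 1) \<le> 0" .
    then show ?thesis
      using vec_cond_exp_T[OF ZT Zi] by eventually_elim (simp add: inner_diff_right inner_axis)
  qed
  then have "AE \<omega> in M. \<forall>i j. Z \<omega> $ j \<le> \<pi> T \<omega> $ i $ j * Z \<omega> $ i"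
    by (simp add: AE_all_countable)
  then show ?thesis
    using pos AE_space
    by eventually_elim (use \<pi>_pos[OF order_refl] \<epsilon> in \<open>auto simp: extra_period_point_def\<close>)
qed

text \<open>The factor \<open>2 ^ (CARD('d) - 1)\<close> cancels the uniform coin weights, and the
  time 0 price in the density is almost surely the constant \<open>E(Z $ n)\<close>. Summing the
  weighted final prices over the coins returns \<open>Z / Z $ n\<close>, whose denominator is
  cancelled by the density.\<close>

lemma pricing_measure_integral:
  fixes X :: "'a \<Rightarrow> real^'d"
  assumes triv: "\<forall>A\<in>sets (F 0). measure M A = 0 \<or> measure M A = 1"
    and Z: "Z \<in> consistent_prices M F T \<pi>" and X: "X \<in> L_infty M (F T)" and \<epsilon>: "0 < \<epsilon>"
  shows "(\<integral>x. (case x of (\<omega>, w) \<Rightarrow> final_price (\<pi> T) n \<epsilon> (\<omega>, w) \<bullet> X \<omega>)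
      \<partial>density (ext_measure M n) (\<lambda>(\<omega>, w). ennreal
        (2 ^ (CARD('d) - 1) * (Z \<omega> $ n / vec_cond_exp M (F 0) Z \<omega> $ n)
          * lambda_weight (\<pi> T) n \<epsilon> Z \<omega> w)))
    = (\<integral>\<omega>. Z \<omega> \<bullet> X \<omega> \<partial>M) / (\<integral>\<omega>. Z \<omega> $ n \<partial>M)"
proof -
  note G = sub[OF order_refl]
  have Zi: "integrable M Z" and ZT: "Z \<in> borel_measurable (F T)" and pos: "AE \<omega> in M. \<forall>i. 0 < Z \<omega> $ i"
    using Z by (auto simp: consistent_prices_def)
  note ZM[measurable] = measurable_from_subalg[OF G ZT]
  note \<pi>M[measurable] = measurable_from_subalg[OF G \<pi>_measurable[OF order_refl]]
  obtain C where C: "AE \<omega> in M. norm (X \<omega>) \<le> C" and XT: "X \<in> borel_measurable (F T)"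
    using X by (auto simp: L_infty_def)
  note XM[measurable] = measurable_from_subalg[OF G XT]
  interpret F0: finite_measure_subalgebra M "F 0" by (rule finite_subalgebra) simp
  note VM[measurable] = measurable_from_subalg[OF F0.subalg F0.vec_cond_exp_measurable[of Z]]
  define c where "c = (\<integral>\<omega>. Z \<omega> $ n \<partial>M)"
  have "AE \<omega> in M. 0 < Z \<omega> $ n" using pos by eventually_elim simp
  then have c: "0 < c" unfolding c_def by (intro expectation_pos integrable_vec_nth Zi)
  have Vc: "AE \<omega> in M. vec_cond_exp M (F 0) Z \<omega> $ n = c"
    using real_cond_exp_trivial[OF prob_space_axioms F0.subalg triv integrable_vec_nth[OF Zi, of n]]
    by (simp add: vec_cond_exp_def c_def)
  note point = extra_period_point_AE[OF Z \<epsilon>]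
  let ?k = "2 ^ (CARD('d) - 1) :: real"
  let ?lam = "\<lambda>\<omega> w. lambda_weight (\<pi> T) n \<epsilon> Z \<omega> w"
  let ?Y = "\<lambda>\<omega> w. final_price (\<pi> T) n \<epsilon> (\<omega>, w)"
  define D where "D x = (case x of (\<omega>, w) \<Rightarrow> ?k * (Z \<omega> $ n / vec_cond_exp M (F 0) Z \<omega> $ n) * ?lam \<omega> w)" for x
  define YX where "YX x = (case x of (\<omega>, w) \<Rightarrow> ?Y \<omega> w \<bullet> X \<omega>)" for x
  \<comment> \<open>The integrand without the factor \<open>?k / c\<close>, which can be extracted
    only almost everywhere because the conditional expectation equals \<open>c\<close> only
    there.\<close>
  define g where "g w \<omega> = Z \<omega> $ n * ?lam \<omega> w * (?Y \<omega> w \<bullet> X \<omega>)" for w \<omega>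
  have lam_m[measurable]: "(\<lambda>\<omega>. ?lam \<omega> w) \<in> borel_measurable M" for w
    by (rule lambda_weight_measurable[OF \<pi>M ZM])
  have Y_m[measurable]: "(\<lambda>\<omega>. ?Y \<omega> w) \<in> borel_measurable M" for w
    by (rule final_price_measurable[OF \<pi>M])
  have D_m: "D \<in> borel_measurable (ext_measure M n)"
    by (rule measurable_ext_measure) (simp add: D_def)
  have YX_m: "YX \<in> borel_measurable (ext_measure M n)"
    by (rule measurable_ext_measure) (simp add: YX_def)
  \<comment> \<open>Needed because \<open>ennreal\<close> in the density sends negative values to
    0.\<close>
  have "AE \<omega> in M. \<forall>w\<in>coin_space n. 0 \<le> D (\<omega>, w)"
    using point Vc pos
  proof eventually_elim
    case (elim \<omega>)
    interpret extra_period_point "\<pi> T" n \<epsilon> Z \<omega> by fact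
    have "0 \<le> Z \<omega> $ n" "0 < vec_cond_exp M (F 0) Z \<omega> $ n"
      using Z_pos[of n] elim(2) c by simp_all
    then show ?case
      unfolding D_def prod.case
      by (intro ballI mult_nonneg_nonneg lambda_weight_nonneg divide_nonneg_pos zero_le_power) auto
  qed
  then have D0: "AE x in ext_measure M n. 0 \<le> D x"
    using D_m by (intro AE_ext_measure[OF prob_space_axioms]) measurable
  \<comment> \<open>Bid and ask prices are unbounded, so \<open>Y\<close> cannot be bounded by a
    constant. The weighted bound with this constant dominates each summand by a multiple of
    \<open>Z $ j\<close>, which is integrable.\<close>
  let ?K = "1 + 2 * \<bar>1 - \<epsilon>\<bar>"
  have g_int: "integrable M (g w)" if w: "w \<in> coin_space n" for w
  proof (rule Bochner_Integration.integrable_bound)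
    show "integrable M (\<lambda>\<omega>. \<Sum>j\<in>UNIV. ?K * \<bar>C\<bar> * Z \<omega> $ j)"
      by (intro Bochner_Integration.integrable_sum integrable_mult_right integrable_vec_nth Zi)
    show "g w \<in> borel_measurable M" unfolding g_def by measurable
    show "AE \<omega> in M. norm (g w \<omega>) \<le> norm (\<Sum>j\<in>UNIV. ?K * \<bar>C\<bar> * Z \<omega> $ j)"
      using point C
    proof eventually_elim
      case (elim \<omega>)
      interpret extra_period_point "\<pi> T" n \<epsilon> Z \<omega> by fact
      have Zn: "0 < Z \<omega> $ n" by (rule Z_pos)
      have j: "\<bar>Z \<omega> $ n * wt w * (Y w $ j * X \<omega> $ j)\<bar> \<le> ?K * \<bar>C\<bar> * Z \<omega> $ j" for j
      proof -
        have "\<bar>Z \<omega> $ n * wt w * (Y w $ j * X \<omega> $ j)\<bar> = Z \<omega> $ n * (wt w * \<bar>Y w $ j\<bar>) * \<bar>X \<omega> $ j\<bar>"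
          using Zn lambda_weight_nonneg[of w] by (simp add: abs_mult)
        also have "\<dots> \<le> Z \<omega> $ n * (?K * z j) * \<bar>C\<bar>"
        proof (rule mult_mono)
          show "Z \<omega> $ n * (wt w * \<bar>Y w $ j\<bar>) \<le> Z \<omega> $ n * (?K * z j)"
            using Zn by (intro mult_left_mono lambda_weight_price_bound w) auto
          show "\<bar>X \<omega> $ j\<bar> \<le> \<bar>C\<bar>" using component_le_norm_cart[of "X \<omega>" j] elim(2) by linarith
          show "0 \<le> Z \<omega> $ n * (?K * z j)" using Zn price_bounds[of j] by (intro mult_nonneg_nonneg) auto
        qed auto
        also have "\<dots> = ?K * \<bar>C\<bar> * Z \<omega> $ j" using Zn by simp
        finally show ?thesis .
      qed
      have "norm (g w \<omega>) = \<bar>\<Sum>j\<in>UNIV. Z \<omega> $ n * wt w * (Y w $ j * X \<omega> $ j)\<bar>"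
        by (simp only: g_def inner_vec_def inner_real_def sum_distrib_left real_norm_def)
      also have "\<dots> \<le> (\<Sum>j\<in>UNIV. \<bar>Z \<omega> $ n * wt w * (Y w $ j * X \<omega> $ j)\<bar>)" by (rule sum_abs)
      also have "\<dots> \<le> (\<Sum>j\<in>UNIV. ?K * \<bar>C\<bar> * Z \<omega> $ j)" by (intro sum_mono j)
      also have "\<dots> \<le> norm (\<Sum>j\<in>UNIV. ?K * \<bar>C\<bar> * Z \<omega> $ j)" by (simp only: real_norm_def abs_ge_self)
      finally show ?case .
    qed
  qed
  have g_sum: "AE \<omega> in M. (\<Sum>w\<in>coin_space n. g w \<omega>) = Z \<omega> \<bullet> X \<omega>"
    using point
  proof eventually_elim
    case (elim \<omega>)
    interpret extra_period_point "\<pi> T" n \<epsilon> Z \<omega> by fact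
    have "(\<Sum>w\<in>coin_space n. g w \<omega>) = (\<Sum>w\<in>coin_space n. \<Sum>j\<in>UNIV. Z \<omega> $ n * X \<omega> $ j * (wt w * Y w $ j))"
      by (simp only: g_def inner_vec_def inner_real_def sum_distrib_left mult_ac)
    also have "\<dots> = (\<Sum>j\<in>UNIV. Z \<omega> $ n * X \<omega> $ j * (\<Sum>w\<in>coin_space n. wt w * Y w $ j))"
      by (subst sum.swap) (simp only: sum_distrib_left)
    also have "\<dots> = (\<Sum>j\<in>UNIV. Z \<omega> $ j * X \<omega> $ j)"
      unfolding sum_lambda_weight_price using Z_pos[of n] by (intro sum.cong refl) simp
    finally show ?case by (simp only: inner_vec_def inner_real_def)
  qed
  have h_eq: "AE \<omega> in M. D (\<omega>, w) * YX (\<omega>, w) = ?k / c * g w \<omega>" for w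
    using Vc by eventually_elim (simp add: D_def YX_def g_def)
  have h_m: "(\<lambda>\<omega>. D (\<omega>, w) * YX (\<omega>, w)) \<in> borel_measurable M" for w
    unfolding D_def YX_def prod.case by measurable
  have g_m: "g w \<in> borel_measurable M" for w unfolding g_def by measurable
  have h_int: "integrable M (\<lambda>\<omega>. D (\<omega>, w) * YX (\<omega>, w))" if "w \<in> coin_space n" for w
    using h_eq integrable_mult_right[OF g_int[OF that], of "?k / c"]
    by (subst integrable_cong_AE[OF h_m]) (auto intro!: borel_measurable_times g_m)
  have "(\<integral>x. YX x \<partial>density (ext_measure M n) (\<lambda>x. ennreal (D x))) = (\<integral>x. D x * YX x \<partial>ext_measure M n)"
    using integral_density[OF YX_m D_m D0] by simp
  also have "\<dots> = (\<Sum>w\<in>coin_space n. \<integral>\<omega>. D (\<omega>, w) * YX (\<omega>, w) \<partial>M) / ?k"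
    by (rule integral_ext_measure[OF prob_space_axioms h_int])
  also have "(\<Sum>w\<in>coin_space n. \<integral>\<omega>. D (\<omega>, w) * YX (\<omega>, w) \<partial>M) = (\<Sum>w\<in>coin_space n. ?k / c * (\<integral>\<omega>. g w \<omega> \<partial>M))"
  proof (intro sum.cong refl)
    fix w
    have "(\<integral>\<omega>. D (\<omega>, w) * YX (\<omega>, w) \<partial>M) = (\<integral>\<omega>. ?k / c * g w \<omega> \<partial>M)"
      by (rule integral_cong_AE[OF h_m _ h_eq]) (intro borel_measurable_times g_m borel_measurable_const)
    then show "(\<integral>\<omega>. D (\<omega>, w) * YX (\<omega>, w) \<partial>M) = ?k / c * (\<integral>\<omega>. g w \<omega> \<partial>M)"
      by simp
  qed
  also have "\<dots> = ?k / c * (\<integral>\<omega>. (\<Sum>w\<in>coin_space n. g w \<omega>) \<partial>M)"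
    by (simp only: sum_distrib_left Bochner_Integration.integral_sum[OF g_int])
  also have "(\<integral>\<omega>. (\<Sum>w\<in>coin_space n. g w \<omega>) \<partial>M) = (\<integral>\<omega>. Z \<omega> \<bullet> X \<omega> \<partial>M)"
    by (rule integral_cong_AE[OF _ _ g_sum]) (auto intro!: borel_measurable_sum g_m)
  also have "?k / c * (\<integral>\<omega>. Z \<omega> \<bullet> X \<omega> \<partial>M) / ?k = (\<integral>\<omega>. Z \<omega> \<bullet> X \<omega> \<partial>M) / c"
    by simp
  finally show ?thesis
    unfolding c_def YX_def[abs_def] D_def[abs_def]
    by (simp only: case_prod_unfold)
qed

text \<open>Conditional expectations are homogeneous only almost surely, which suffices since the
  polar inequalities are almost sure statements.\<close>

lemma consistent_prices_scaleR:
  assumes Z: "Z \<in> consistent_prices M F T \<pi>" and r: "0 < r"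
  shows "(\<lambda>\<omega>. r *\<^sub>R Z \<omega>) \<in> consistent_prices M F T \<pi>"
proof -
  have Zi: "integrable M Z" and ZT: "Z \<in> borel_measurable (F T)" and pos: "AE \<omega> in M. \<forall>i. 0 < Z \<omega> $ i"
    and pol: "\<And>t. t \<le> T \<Longrightarrow> vec_cond_exp M (F t) Z \<in> polar_cone M (F t) (trading_cone M (F t) (\<pi> t))"
    using Z by (auto simp: consistent_prices_def)
  have "vec_cond_exp M (F t) (\<lambda>\<omega>. r *\<^sub>R Z \<omega>) \<in> polar_cone M (F t) (trading_cone M (F t) (\<pi> t))"
    if t: "t \<le> T" for t
  proof -
    interpret t: finite_measure_subalgebra M "F t" by (rule finite_subalgebra[OF t])
    have "AE \<omega> in M. real_cond_exp M (F t) (\<lambda>\<omega>. r * Z \<omega> $ i) \<omega> = r * real_cond_exp M (F t) (\<lambda>\<omega>. Z \<omega> $ i) \<omega>" for i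
      by (rule t.real_cond_exp_cmult[OF integrable_vec_nth[OF Zi]])
    then have "AE \<omega> in M. \<forall>i. real_cond_exp M (F t) (\<lambda>\<omega>. r * Z \<omega> $ i) \<omega> = r * real_cond_exp M (F t) (\<lambda>\<omega>. Z \<omega> $ i) \<omega>"
      by (subst AE_all_countable) blast
    then have eq: "AE \<omega> in M. vec_cond_exp M (F t) (\<lambda>\<omega>. r *\<^sub>R Z \<omega>) \<omega> = r *\<^sub>R vec_cond_exp M (F t) Z \<omega>"
      by eventually_elim (simp add: vec_cond_exp_def vec_eq_iff)
    have "AE \<omega> in M. vec_cond_exp M (F t) (\<lambda>\<omega>. r *\<^sub>R Z \<omega>) \<omega> \<bullet> \<xi> \<omega> \<le> 0"
      if "\<xi> \<in> trading_cone M (F t) (\<pi> t)" for \<xi>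
    proof -
      have "AE \<omega> in M. vec_cond_exp M (F t) Z \<omega> \<bullet> \<xi> \<omega> \<le> 0"
        by (rule polar_coneD[OF pol[OF t] that])
      then show ?thesis
        using eq by eventually_elim (use r in \<open>simp add: mult_nonneg_nonpos\<close>)
    qed
    moreover have "integrable M (\<lambda>\<omega>. r *\<^sub>R Z \<omega>)" using Zi by simp
    ultimately show ?thesis
      unfolding polar_cone_def
      by (intro CollectI conjI t.vec_cond_exp_measurable t.vec_cond_exp_integrable ballI)
  qed
  moreover have "AE \<omega> in M. \<forall>i. 0 < (r *\<^sub>R Z \<omega>) $ i"
    using pos by eventually_elim (use r in simp)
  ultimately show ?thesis
    unfolding consistent_prices_def using Zi ZT by simp
qed

end

theorem theorem8p3:
  fixes M :: "'a measure" and F :: "nat \<Rightarrow> 'a measure" and T :: nat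
    and \<pi> :: "nat \<Rightarrow> 'a \<Rightarrow> real^'d^'d" and n :: 'd and \<epsilon> :: real
  defines "\<B> \<equiv> attainable M F T \<pi>"
    and "\<B>o \<equiv> consistent_prices M F T \<pi>"
    and "\<Q> \<equiv> pricing_measures M F T \<pi> n \<epsilon>"
    and "YX \<equiv> \<lambda>(X :: 'a \<Rightarrow> real^'d) (\<omega>, w). final_price (\<pi> T) n \<epsilon> (\<omega>, w) \<bullet> X \<omega>"
  assumes "filtered_prob_space M F T"
    and F0_trivial: "\<forall>A\<in>sets (F 0). measure M A = 0 \<or> measure M A = 1"
    and "bid_ask_process M F T \<pi>"
    and "closed_L0 M (F T) \<B>"
    and "arbitrage_free M \<B>"
    and "0 < \<epsilon>"
  shows "(\<forall>X\<in>L_infty M (F T).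
           coherent_risk \<Q> (YX X) =
             (SUP Z\<in>{Z \<in> \<B>o. (\<integral>\<omega>. Z \<omega> $ n \<partial>M) = 1}. ereal (\<integral>\<omega>. Z \<omega> \<bullet> X \<omega> \<partial>M)))
       \<and> \<B> \<inter> L_infty M (F T) = {X \<in> L_infty M (F T). \<forall>Q\<in>\<Q>. (\<integral>x. YX X x \<partial>Q) \<le> 0}
       \<and> {X \<in> L_infty M (F T). \<forall>Q\<in>\<Q>. (\<integral>x. YX X x \<partial>Q) \<le> 0} =
           {X \<in> L_infty M (F T). coherent_risk \<Q> (YX X) \<le> 0}"
proof -
  interpret prob_space M using assms(5) by (simp add: filtered_prob_space_def)
  interpret arbitrage_free_market M F T \<pi>
    using assms by unfold_locales (simp_all add: filtered_prob_space_def)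
  define q where "q Z = density (ext_measure M n) (\<lambda>(\<omega>, w). ennreal
        (2 ^ (CARD('d) - 1) * (Z \<omega> $ n / vec_cond_exp M (F 0) Z \<omega> $ n)
          * lambda_weight (\<pi> T) n \<epsilon> Z \<omega> w))" for Z
  have Q: "\<Q> = q ` \<B>o" by (simp only: \<Q>_def pricing_measures_def \<B>o_def q_def[abs_def])
  define m where "m Z = (\<integral>\<omega>. Z \<omega> $ n \<partial>M)" for Z :: "'a \<Rightarrow> real^'d"
  have m_pos: "0 < m Z" if "Z \<in> \<B>o" for Z
  proof -
    have "AE \<omega> in M. \<forall>i. 0 < Z \<omega> $ i" "integrable M Z" using that by (auto simp: \<B>o_def consistent_prices_def)
    then show ?thesis
      unfolding m_def by (intro expectation_pos integrable_vec_nth) (auto elim: eventually_mono)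
  qed
  have int: "(\<integral>x. YX X x \<partial>q Z) = (\<integral>\<omega>. Z \<omega> \<bullet> X \<omega> \<partial>M) / m Z"
    if "Z \<in> \<B>o" "X \<in> L_infty M (F T)" for X Z
    unfolding YX_def q_def m_def
    by (rule pricing_measure_integral[OF F0_trivial that[unfolded \<B>o_def] \<open>0 < \<epsilon>\<close>])
  have "coherent_risk \<Q> (YX X) = (SUP Z\<in>{Z \<in> \<B>o. m Z = 1}. ereal (\<integral>\<omega>. Z \<omega> \<bullet> X \<omega> \<partial>M))"
    if X: "X \<in> L_infty M (F T)" for X
    unfolding coherent_risk_def Q image_image
  proof (rule antisym)
    show "(SUP Z\<in>\<B>o. ereal (\<integral>x. YX X x \<partial>q Z)) \<le> (SUP Z\<in>{Z \<in> \<B>o. m Z = 1}. ereal (\<integral>\<omega>. Z \<omega> \<bullet> X \<omega> \<partial>M))"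
    proof (rule SUP_least)
      fix Z assume Z: "Z \<in> \<B>o"
      \<comment> \<open>The measure \<open>q Z\<close> prices \<open>X\<close> as the normalized
        process does; conversely, division by \<open>m Z = 1\<close> changes nothing.\<close>
      let ?W = "\<lambda>\<omega>. (1 / m Z) *\<^sub>R Z \<omega>"
      have "?W \<in> \<B>o"
        using consistent_prices_scaleR[of Z "1 / m Z"] Z m_pos[OF Z] by (simp add: \<B>o_def)
      moreover have "m ?W = 1"
        using m_pos[OF Z] by (simp add: m_def)
      moreover have "(\<integral>x. YX X x \<partial>q Z) = (\<integral>\<omega>. ?W \<omega> \<bullet> X \<omega> \<partial>M)"
        unfolding int[OF Z X] by simp
      ultimately show "ereal (\<integral>x. YX X x \<partial>q Z) \<le> (SUP Z\<in>{Z \<in> \<B>o. m Z = 1}. ereal (\<integral>\<omega>. Z \<omega> \<bullet> X \<omega> \<partial>M))"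
        by (intro SUP_upper2[of ?W]) auto
    qed
    show "(SUP Z\<in>{Z \<in> \<B>o. m Z = 1}. ereal (\<integral>\<omega>. Z \<omega> \<bullet> X \<omega> \<partial>M)) \<le> (SUP Z\<in>\<B>o. ereal (\<integral>x. YX X x \<partial>q Z))"
    proof (rule SUP_least)
      fix Z assume "Z \<in> {Z \<in> \<B>o. m Z = 1}"
      then show "ereal (\<integral>\<omega>. Z \<omega> \<bullet> X \<omega> \<partial>M) \<le> (SUP Z\<in>\<B>o. ereal (\<integral>x. YX X x \<partial>q Z))"
        by (intro SUP_upper2[of Z]) (auto simp: int[OF _ X])
    qed
  qed
  moreover have "X \<in> \<B> \<longleftrightarrow> (\<forall>Q\<in>\<Q>. (\<integral>x. YX X x \<partial>Q) \<le> 0)" if X: "X \<in> L_infty M (F T)" for X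
  proof -
    have "(\<integral>x. YX X x \<partial>q Z) \<le> 0 \<longleftrightarrow> (\<integral>\<omega>. Z \<omega> \<bullet> X \<omega> \<partial>M) \<le> 0" if "Z \<in> \<B>o" for Z
      using m_pos[OF that] by (simp add: int[OF that X] divide_le_0_iff)
    then show ?thesis
      using attainable_iff_prices_nonpos[OF X] by (simp add: Q \<B>_def \<B>o_def)
  qed
  moreover have "coherent_risk \<Q> W \<le> 0 \<longleftrightarrow> (\<forall>Q\<in>\<Q>. (\<integral>x. W x \<partial>Q) \<le> 0)" for W
    by (simp add: coherent_risk_def SUP_le_iff)
  ultimately show ?thesis
    unfolding m_def by blast
qed

end
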